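(* Consider two states $(u_-,h_-),(u_+,h_+)\in\Omega$, $u_-\ne u_+$, such that $v_-=v_+$, where $v_\pm=v(u_\pm,h_\pm)$. Then the viscous profile system has infinitely many solutions with $s=0$ connecting $(u_-,h_-)$ to $(u_+,h_+)$.
   Context: Setting (a one-lane traffic model with hysteresis, in Lagrangian coordinates). $u\in[1,\infty)$ is the spacing between vehicles and $h\in[1,\infty)$ is a hysteresis parameter. Given are smooth functions: the acceleration curve $v=v^A(u)$, $u\ge u_0^A$, with $u_0^A>1$ and $v^A(u_0^A)=0$; the deceleration curve $v=v^D(u)$, $u\ge 1$, with $v^D(1)=0$; both are positive apart from these zeros and tend to a common maximum speed $\bar v>0$ as $u\to\infty$. The two curves intersect at exactly one point $u=u_c$; $v^A$ lies below $v^D$ for $u<u_c$ (congested zone) and above $v^D$ for $u>u_c$ (free zone). Also given is a family of scanning curves $v=v^S(u,h)$, one for each value of $h$. Through each point of the acceleration curve and through each point of the deceleration curve there passes a scanning curve. $u^A(h)$ and $u^D(h)$ denote the $u$-coordinates of the intersections of the scanning curve $v=v^S(\cdot,h)$ with $v=v^A(u)$ and $v=v^D(u)$ respectively, so that $v^S(u^A(h),h)=v^A(u^A(h))$ and $v^S(u^D(h),h)=v^D(u^D(h))$. The functions $u^A,u^D$ are invertible, with inverse functions $h^A(u)$, $h^D(u)$, and $h_c:=h^A(u_c)=h^D(u_c)$. Put $$\Omega=\{(u,h)\in[1,\infty)\times[1,\infty): u^D(h)\le u\le u^A(h)\}.$$ Standing assumption: $v^A_u>0$, $v^D_u>0$,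 $v^S_u(u,h)>0$, $v^S_h(u,h)>0$; $u^A(h)\ge u^D(h)$, with equality if and only if $h=h_c$; and $v^A_{uu}<0$, $v^D_{uu}<0$, and $v^S_{uu}(u,h)<0$ for $(u,h)\in\Omega$. The velocity is $$v(u,h)=\begin{cases}v^D(u)& u\le u^D(h),\\ v^S(u,h)& u^D(h)<u<u^A(h),\\ v^A(u)& u\ge u^A(h).\end{cases}$$ Viscous profile system. For two states $(u_\pm,h_\pm)$ with $u_-\ne u_+$, put $v_\pm=v(u_\pm,h_\pm)$ and $s=-\frac{v_+-v_-}{u_+-u_-}$. A solution connecting $(u_-,h_-)$ to $(u_+,h_+)$ is a pair of functions $(u,h)(\xi)$, $\xi\in\mathbb{R}$, satisfying $$u'=-s(u-u_\pm)-(v(u,h)-v_\pm),\qquad s h'=s\chi(A)\,(h^A(u))'+s\chi(D)\,(h^D(u))',$$ $$(u,h)(\pm\infty)=(u_\pm,h_\pm),\qquad (u',h')(\pm\infty)=(0,0),$$ where $'=d/d\xi$, $A=\{su'<0 \text{ and } u=u^A(h)\}$, $D=\{su'>0\text{ and }u=u^D(h)\}$, and $\chi(E)=1$ if $E$ is true, $0$ otherwise. When $v_-=v_+$ one has $s=0$ (the corresponding wave is called a stationary shock), and the system reduces to $u'=-v(u,h)+v_-$, $(u,h)(\pm\infty)=(u_\pm,h_\pm)$. *)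

theory Defs
  imports "HOL-Analysis.Analysis"
begin

primrec times_cont_diff_on :: "nat \<Rightarrow> ('a::real_normed_vector \<Rightarrow> real) \<Rightarrow> 'a set \<Rightarrow> bool" where
  "times_cont_diff_on 0 f S \<longleftrightarrow> continuous_on S f"
| "times_cont_diff_on (Suc n) f S \<longleftrightarrow>
     (\<forall>x\<in>S. f differentiable (at x)) \<and>
     (\<forall>v. times_cont_diff_on n (\<lambda>x. frechet_derivative f (at x) v) S)"

(* Smoothness on a closed domain means smoothness on some open neighbourhood of it, so that
   two-sided derivatives make sense at the end points; the values outside the domain are
   otherwise never used. *)
definition smooth_around :: "('a::real_normed_vector \<Rightarrow> real) \<Rightarrow> 'a set \<Rightarrow> bool" where
  "smooth_around f D \<longleftrightarrow> (\<exists>N. open N \<and> D \<subseteq> N \<and> (\<forall>n. times_cont_diff_on n f N))"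

(* dom_uD is the set of those h whose scanning curve meets the deceleration curve, i.e. the domain
   of the function uD.  It cannot be all of [1,oo): to the left of u0A, the increasing scanning
   curve through (u0A, 0) is negative, and so does not meet the deceleration curve, which is
   nonnegative. *)
record traffic_curves =
  u0A :: real
  uc :: real
  vmax :: real
  vA :: "real \<Rightarrow> real"
  vD :: "real \<Rightarrow> real"
  vS :: "real \<Rightarrow> real \<Rightarrow> real"
  dom_uD :: "real set"
  uA :: "real \<Rightarrow> real"
  uD :: "real \<Rightarrow> real"

definition hA :: "traffic_curves \<Rightarrow> real \<Rightarrow> real" where
  "hA M = the_inv_into {1..} (uA M)"

definition hD :: "traffic_curves \<Rightarrow> real \<Rightarrow> real" where
  "hD M = the_inv_into (dom_uD M) (uD M)"

definition hc :: "traffic_curves \<Rightarrow> real" where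
  "hc M = hA M (uc M)"

definition Omega :: "traffic_curves \<Rightarrow> (real \<times> real) set" where
  "Omega M = {(u, h). 1 \<le> u \<and> h \<in> dom_uD M \<and> uD M h \<le> u \<and> u \<le> uA M h}"

definition velocity :: "traffic_curves \<Rightarrow> real \<Rightarrow> real \<Rightarrow> real" where
  "velocity M u h =
     (if u \<le> uD M h then vD M u else if u < uA M h then vS M u h else vA M u)"

definition acc_dec_curves :: "traffic_curves \<Rightarrow> bool" where
  "acc_dec_curves M \<longleftrightarrow>
     smooth_around (vA M) {u0A M..} \<and> smooth_around (vD M) {1..} \<and>
     1 < u0A M \<and> vA M (u0A M) = 0 \<and> vD M 1 = 0 \<and>
     (\<forall>u>u0A M. 0 < vA M u) \<and> (\<forall>u>1. 0 < vD M u) \<and>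
     0 < vmax M \<and> (vA M \<longlongrightarrow> vmax M) at_top \<and> (vD M \<longlongrightarrow> vmax M) at_top \<and>
     u0A M \<le> uc M \<and> vA M (uc M) = vD M (uc M) \<and>
     (\<forall>u. u0A M \<le> u \<and> u < uc M \<longrightarrow> vA M u < vD M u) \<and>
     (\<forall>u>uc M. vD M u < vA M u)"

(* The bijections say both that a scanning curve passes through every point of the acceleration
   and of the deceleration curve, and that uA, uD are invertible.
   Continuity of the inverse functions across uc is deliberately not required: since the scanning
   velocity increases with h and uD h < uA h for h other than hc (see standing_assumption), hA and
   hD increase in the congested zone and decrease in the free zone; as they are injective, they
   cannot be continuous across uc. *)
definition scanning_curves :: "traffic_curves \<Rightarrow> bool" where
  "scanning_curves M \<longleftrightarrow>
     dom_uD M \<subseteq> {1..} \<and>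
     smooth_around (\<lambda>(u, h). vS M u h) (Omega M) \<and>
     (\<forall>h\<ge>1. vS M (uA M h) h = vA M (uA M h)) \<and>
     (\<forall>h\<in>dom_uD M. vS M (uD M h) h = vD M (uD M h)) \<and>
     (\<forall>(u, h)\<in>Omega M. u0A M \<le> u \<and> vS M u h = vA M u \<longrightarrow> u = uA M h) \<and>
     (\<forall>(u, h)\<in>Omega M. vS M u h = vD M u \<longrightarrow> u = uD M h) \<and>
     bij_betw (uA M) {1..} {u0A M..} \<and> bij_betw (uD M) (dom_uD M) {1..} \<and>
     continuous_on ({u0A M..} - {uc M}) (hA M) \<and> continuous_on ({1..} - {uc M}) (hD M) \<and>
     hA M (uc M) = hD M (uc M)"

definition standing_assumption :: "traffic_curves \<Rightarrow> bool" where
  "standing_assumption M \<longleftrightarrow>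
     (\<forall>u\<ge>u0A M. 0 < deriv (vA M) u) \<and>
     (\<forall>u\<ge>1. 0 < deriv (vD M) u) \<and>
     (\<forall>(u, h)\<in>Omega M. 0 < deriv (\<lambda>x. vS M x h) u \<and> 0 < deriv (vS M u) h) \<and>
     (\<forall>h\<in>dom_uD M. uD M h \<le> uA M h \<and> (uA M h = uD M h \<longleftrightarrow> h = hc M)) \<and>
     (\<forall>u\<ge>u0A M. (deriv ^^ 2) (vA M) u < 0) \<and>
     (\<forall>u\<ge>1. (deriv ^^ 2) (vD M) u < 0) \<and>
     (\<forall>(u, h)\<in>Omega M. (deriv ^^ 2) (\<lambda>x. vS M x h) u < 0)"

definition shock_speed :: "traffic_curves \<Rightarrow> real \<times> real \<Rightarrow> real \<times> real \<Rightarrow> real" where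
  "shock_speed M = (\<lambda>(um, hm) (up, hp).
     - ((velocity M up hp - velocity M um hm) / (up - um)))"

(* The equation for u is the same for the two choices of the sign, by the definition of the speed.
   The component h is continuous but, when s is nonzero, has corners where the solution reaches
   or leaves one of the two curves; hence the finite exceptional set K. *)
definition viscous_profile ::
  "traffic_curves \<Rightarrow> real \<times> real \<Rightarrow> real \<times> real \<Rightarrow> (real \<Rightarrow> real) \<Rightarrow> (real \<Rightarrow> real) \<Rightarrow> bool" where
  "viscous_profile M = (\<lambda>(um, hm) (up, hp) u h.
     let s = shock_speed M (um, hm) (up, hp);
         A = (\<lambda>\<xi>. s * deriv u \<xi> < 0 \<and> u \<xi> = uA M (h \<xi>));
         D = (\<lambda>\<xi>. s * deriv u \<xi> > 0 \<and> u \<xi> = uD M (h \<xi>))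
     in
       (\<forall>\<xi>. 1 \<le> u \<xi> \<and> h \<xi> \<in> dom_uD M) \<and>
       (\<forall>\<xi>. (u has_real_derivative
               - s * (u \<xi> - um) - (velocity M (u \<xi>) (h \<xi>) - velocity M um hm)) (at \<xi>)) \<and>
       continuous_on UNIV h \<and>
       (\<exists>K. finite K \<and> (\<forall>\<xi>. \<xi> \<notin> K \<longrightarrow>
          h differentiable (at \<xi>) \<and>
          (A \<xi> \<longrightarrow> (\<lambda>\<eta>. hA M (u \<eta>)) differentiable (at \<xi>)) \<and>
          (D \<xi> \<longrightarrow> (\<lambda>\<eta>. hD M (u \<eta>)) differentiable (at \<xi>)) \<and>
          s * deriv h \<xi> =
            s * of_bool (A \<xi>) * deriv (\<lambda>\<eta>. hA M (u \<eta>)) \<xi> +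
            s * of_bool (D \<xi>) * deriv (\<lambda>\<eta>. hD M (u \<eta>)) \<xi>)) \<and>
       (u \<longlongrightarrow> um) at_bot \<and> (h \<longlongrightarrow> hm) at_bot \<and>
       (u \<longlongrightarrow> up) at_top \<and> (h \<longlongrightarrow> hp) at_top \<and>
       (deriv u \<longlongrightarrow> 0) at_bot \<and> (deriv h \<longlongrightarrow> 0) at_bot \<and>
       (deriv u \<longlongrightarrow> 0) at_top \<and> (deriv h \<longlongrightarrow> 0) at_top)"

end

theory Submission
  imports Defs "HOL-Real_Asymp.Real_Asymp"
begin

text \<open>
  A stationary profile only has to satisfy \<open>u' = v\<^sub>- - v(u, h)\<close>: for \<open>s = 0\<close> nothing prescribes \<open>h\<close>.
  So one may choose \<open>u\<close> and let the equation determine \<open>h\<close>. For a small \<open>\<kappa> > 0\<close> let \<open>u\<close> be the logistic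
  curve with \<open>u' = \<kappa> (u - u\<^sub>-) (u\<^sub>+ - u) / (u\<^sub>+ - u\<^sub>-)\<close>, which joins \<open>u\<^sub>-\<close> to \<open>u\<^sub>+\<close>, and let
  \<open>h = g(u)\<close>, where \<open>g\<close> solves \<open>v(x, g x) = v\<^sub>- - \<kappa> (x - u\<^sub>-) (u\<^sub>+ - x) / (u\<^sub>+ - u\<^sub>-)\<close>. Each \<open>\<kappa>\<close> gives
  its own profile, hence there are infinitely many.

  It remains to solve for \<open>g\<close>. Since velocity increases with both \<open>u\<close> and \<open>h\<close>, of the two states
  \<open>(ul, hr)\<close>, \<open>(ur, hl)\<close> with \<open>ul < ur\<close> the second has the smaller \<open>h\<close>
  (\<open>hysteresis_decreases\<close>). For \<open>x\<close> between \<open>ul\<close> and \<open>ur\<close> the common velocity lies between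
  \<open>v(x, hl)\<close> and \<open>v(x, hr)\<close>, with a margin that is linear in the distance to the ends
  (\<open>velocity_growth_left\<close>, \<open>velocity_growth_right\<close>), and so do nearby values. The intermediate value
  theorem in \<open>h\<close> and implicit differentiation then give \<open>g\<close> (\<open>level_curve\<close>).

  This needs all \<open>h\<close> between \<open>hl\<close> and \<open>hr\<close> to belong to scanning curves whose end points \<open>uD h\<close>,
  \<open>uA h\<close> depend continuously and monotonically on \<open>h\<close> (\<open>connecting_box\<close>). The assumptions give
  continuity only for the inverse functions, and only away from \<open>uc\<close>. A topological argument turns this
  into continuity and strict monotonicity of \<open>uA\<close> and \<open>uD\<close> on branches, the side from which a
  scanning curve meets the acceleration or deceleration curve tells the direction
  (\<open>uA_directions\<close>, \<open>uD_directions\<close>), and comparing the directions shows that no scanning curve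
  starts on one side of \<open>uc\<close> and ends on the other (\<open>congested_uA\<close>). Hence the congested and the
  free zone are separate, they are distinguished by velocity, and two states of equal velocity
  and different spacing lie in the same zone.
\<close>

section \<open>Derivatives, monotone branches and implicit curves\<close>

lemma smooth_around_real:
  fixes f :: "real \<Rightarrow> real"
  assumes "smooth_around f D"
  shows "\<And>x. x \<in> D \<Longrightarrow> (f has_real_derivative deriv f x) (at x)"
    and "continuous_on D (deriv f)"
proof -
  obtain N where N: "open N" "D \<subseteq> N" "\<And>n. times_cont_diff_on n f N"
    using assms unfolding smooth_around_def by blast
  have diff: "f differentiable (at x)" if "x \<in> N" for x
    using N(3)[of "Suc 0"] that by simp
  have der: "(f has_real_derivative deriv f x) (at x)" if "x \<in> N" for x
    using diff[OF that] by (metis DERIV_deriv_iff_real_differentiable)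
  then show "\<And>x. x \<in> D \<Longrightarrow> (f has_real_derivative deriv f x) (at x)"
    using N(2) by auto
  have "frechet_derivative f (at x) 1 = deriv f x" if "x \<in> N" for x
    using frechet_derivative_at[OF der[OF that, unfolded has_field_derivative_def]] by (metis mult.right_neutral)
  moreover have "continuous_on N (\<lambda>x. frechet_derivative f (at x) 1)"
    using N(3)[of "Suc 0"] by simp
  ultimately have "continuous_on N (deriv f)"
    by (metis (no_types, lifting) continuous_on_cong)
  then show "continuous_on D (deriv f)"
    using N(2) continuous_on_subset by blast
qed

lemma smooth_around_plane:
  fixes f :: "real \<Rightarrow> real \<Rightarrow> real"
  assumes "smooth_around (\<lambda>(u, h). f u h) D"
  shows "\<And>u h. (u, h) \<in> D \<Longrightarrow>
      ((\<lambda>(u, h). f u h) has_derivative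
        (\<lambda>(a, b). a * deriv (\<lambda>x. f x h) u + b * deriv (f u) h)) (at (u, h))"
    and "continuous_on D (\<lambda>(u, h). deriv (\<lambda>x. f x h) u)"
    and "continuous_on D (\<lambda>(u, h). deriv (f u) h)"
    and "\<And>u h. (u, h) \<in> D \<Longrightarrow> ((\<lambda>x. f x h) has_real_derivative deriv (\<lambda>x. f x h) u) (at u)"
    and "\<And>u h. (u, h) \<in> D \<Longrightarrow> (f u has_real_derivative deriv (f u) h) (at h)"
proof -
  let ?F = "\<lambda>(u, h). f u h"
  obtain N where N: "open N" "D \<subseteq> N" "\<And>n. times_cont_diff_on n ?F N"
    using assms unfolding smooth_around_def by blast
  let ?d = "\<lambda>p. frechet_derivative ?F (at p)"
  have der: "(?F has_derivative ?d p) (at p)" if "p \<in> N" for p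
    using N(3)[of "Suc 0"] that by (simp add: frechet_derivative_works)
  have du: "((\<lambda>x. f x h) has_real_derivative ?d (u, h) (1, 0)) (at u)" if "(u, h) \<in> N" for u h
  proof -
    have lin: "linear (?d (u, h))" using der[OF that] by (rule has_derivative_linear)
    have "((\<lambda>x. ?F (x, h)) has_derivative (\<lambda>a. ?d (u, h) (a, 0))) (at u)"
      using has_derivative_compose[of "\<lambda>x. (x, h)" "\<lambda>a. (a, 0)" u UNIV ?F "?d (u, h)"] der[OF that]
      by (simp add: has_derivative_Pair)
    moreover have "(\<lambda>a. ?d (u, h) (a, 0)) = (*) (?d (u, h) (1, 0))"
    proof
      show "?d (u, h) (a, 0) = ?d (u, h) (1, 0) * a" for a
        using linear_scale[OF lin, of a "(1, 0)"] by simp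
    qed
    ultimately show ?thesis unfolding has_field_derivative_def by simp
  qed
  have dh: "(f u has_real_derivative ?d (u, h) (0, 1)) (at h)" if "(u, h) \<in> N" for u h
  proof -
    have lin: "linear (?d (u, h))" using der[OF that] by (rule has_derivative_linear)
    have "((\<lambda>x. ?F (u, x)) has_derivative (\<lambda>a. ?d (u, h) (0, a))) (at h)"
      using has_derivative_compose[of "\<lambda>x. (u, x)" "\<lambda>a. (0, a)" h UNIV ?F "?d (u, h)"] der[OF that]
      by (simp add: has_derivative_Pair)
    moreover have "(\<lambda>a. ?d (u, h) (0, a)) = (*) (?d (u, h) (0, 1))"
    proof
      show "?d (u, h) (0, a) = ?d (u, h) (0, 1) * a" for a
        using linear_scale[OF lin, of a "(0, 1)"] by simp
    qed
    ultimately show ?thesis unfolding has_field_derivative_def by simp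
  qed
  have eu: "deriv (\<lambda>x. f x h) u = ?d (u, h) (1, 0)" and eh: "deriv (f u) h = ?d (u, h) (0, 1)"
    if "(u, h) \<in> N" for u h
    using du[OF that] dh[OF that] DERIV_imp_deriv by blast+
  show "((\<lambda>x. f x h) has_real_derivative deriv (\<lambda>x. f x h) u) (at u)"
    "(f u has_real_derivative deriv (f u) h) (at h)" if "(u, h) \<in> D" for u h
    using that N(2) du[of u h] dh[of u h] eu[of u h] eh[of u h] by auto
  have c: "continuous_on N (\<lambda>p. ?d p v)" for v
    using N(3)[of "Suc 0"] by (cases v) simp
  show "continuous_on D (\<lambda>(u, h). deriv (\<lambda>x. f x h) u)"
    by (rule continuous_on_eq[OF continuous_on_subset[OF c[of "(1, 0)"] N(2)]])
      (use eu N(2) in auto)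
  show "continuous_on D (\<lambda>(u, h). deriv (f u) h)"
    by (rule continuous_on_eq[OF continuous_on_subset[OF c[of "(0, 1)"] N(2)]])
      (use eh N(2) in auto)
  fix u h assume D: "(u, h) \<in> D"
  then have N': "(u, h) \<in> N" using N(2) by auto
  have lin: "linear (?d (u, h))" using der[OF N'] by (rule has_derivative_linear)
  have eq: "?d (u, h) (a, b) = a * deriv (\<lambda>x. f x h) u + b * deriv (f u) h" for a b
  proof -
    have "?d (u, h) (a, b) = ?d (u, h) (a *\<^sub>R (1, 0) + b *\<^sub>R (0, 1))" by simp
    also have "\<dots> = a * ?d (u, h) (1, 0) + b * ?d (u, h) (0, 1)"
      by (simp only: linear_add[OF lin] linear_scale[OF lin] real_scaleR_def)
    finally show ?thesis unfolding eu[OF N'] eh[OF N'] .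
  qed
  have "?d (u, h) = (\<lambda>(a, b). a * deriv (\<lambda>x. f x h) u + b * deriv (f u) h)"
    by (rule ext) (clarsimp simp only: eq split_paired_all prod.case)
  then show "(?F has_derivative (\<lambda>(a, b). a * deriv (\<lambda>x. f x h) u + b * deriv (f u) h)) (at (u, h))"
    using der[OF N'] by (simp only:)
qed

text \<open>
  The implicit function theorem in the form in which the curve is already given and known to be
  continuous: then differentiability of \<open>F\<close> at the single point \<open>(x, g x)\<close> is enough. The remainder of
  the linear approximation is \<open>o(\<bar>y - x\<bar> + \<bar>g y - g x\<bar>)\<close>, so it can be absorbed into the
  coefficients \<open>p\<close> and \<open>q\<close> with errors \<open>\<alpha>\<close> and \<open>\<beta>\<close> that tend to 0, and the resulting linear
  equation is solved for the difference quotient of \<open>g\<close>.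
\<close>

lemma implicit_derivative:
  fixes F :: "real \<times> real \<Rightarrow> real" and g w :: "real \<Rightarrow> real"
  assumes F: "(F has_derivative (\<lambda>(a, b). a * p + b * q)) (at (x, g x))" and q: "q \<noteq> 0"
    and g: "isCont g x" and w: "(w has_real_derivative w') (at x)"
    and level: "\<forall>\<^sub>F y in at x. F (y, g y) = w y" and level0: "F (x, g x) = w x"
  shows "(g has_real_derivative (w' - p) / q) (at x)"
proof -
  define r where "r = (\<lambda>z. (F z - F (x, g x) - ((fst z - x) * p + (snd z - g x) * q)) / norm (z - (x, g x)))"
  define E where "E = (\<lambda>y. r (y, g y))"
  have "(r \<longlongrightarrow> 0) (at (x, g x))"
    using F unfolding has_derivative_at_within r_def
    by (simp add: case_prod_unfold divide_inverse mult.commute)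
  then have "isCont r (x, g x)" unfolding isCont_def by (simp add: r_def)
  moreover have "isCont (\<lambda>y. (y, g y)) x" using g by (intro continuous_intros)
  ultimately have "isCont E x" unfolding E_def
    using isCont_o2[where f = "\<lambda>y. (y, g y)" and g = r and a = x] by simp
  then have E: "(E \<longlongrightarrow> 0) (at x)" unfolding isCont_def by (simp add: E_def r_def)
  define n where "n = (\<lambda>y. norm (y - x, g y - g x))"
  define \<alpha> where "\<alpha> = (\<lambda>y. E y * ((y - x) / n y))"
  define \<beta> where "\<beta> = (\<lambda>y. E y * ((g y - g x) / n y))"
  have le: "\<bar>a / norm (a, b)\<bar> \<le> 1" "\<bar>b / norm (a, b)\<bar> \<le> 1" for a b :: real
    using norm_fst_le[of a b] norm_snd_le[of b a] by (auto simp: abs_divide divide_le_eq_1)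
  have "\<bar>\<alpha> y\<bar> \<le> \<bar>E y\<bar>" "\<bar>\<beta> y\<bar> \<le> \<bar>E y\<bar>" for y
    unfolding \<alpha>_def \<beta>_def n_def abs_mult
    using mult_left_mono[OF le(1)[of "y - x" "g y - g x"], of "\<bar>E y\<bar>"]
      mult_left_mono[OF le(2)[of "g y - g x" "y - x"], of "\<bar>E y\<bar>"] by auto
  then have \<alpha>: "(\<alpha> \<longlongrightarrow> 0) (at x)" and \<beta>: "(\<beta> \<longlongrightarrow> 0) (at x)"
    using E by (auto intro!: Lim_null_comparison[OF _ tendsto_rabs_zero[OF E]])
  have "((\<lambda>y. q + \<beta> y) \<longlongrightarrow> q) (at x)" using tendsto_add[OF tendsto_const \<beta>] by simp
  then have nz: "\<forall>\<^sub>F y in at x. q + \<beta> y \<noteq> 0" using q by (rule tendsto_imp_eventually_ne)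
  have "((\<lambda>y. (w y - w x) / (y - x)) \<longlongrightarrow> w') (at x)" using w by (simp add: has_field_derivative_iff)
  then have lim: "((\<lambda>y. ((w y - w x) / (y - x) - (p + \<alpha> y)) / (q + \<beta> y)) \<longlongrightarrow> (w' - (p + 0)) / (q + 0)) (at x)"
    using \<alpha> \<beta> q by (intro tendsto_intros) auto
  have "\<forall>\<^sub>F y in at x. ((w y - w x) / (y - x) - (p + \<alpha> y)) / (q + \<beta> y) = (g y - g x) / (y - x)"
    using nz level eventually_at_filter[of "\<lambda>y. y \<noteq> x" x UNIV, simplified]
  proof eventually_elim
    case (elim y)
    have n: "n y \<noteq> 0" using elim(3) by (auto simp: n_def zero_prod_def)
    have n2: "n y * n y = (y - x)\<^sup>2 + (g y - g x)\<^sup>2"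
      by (simp add: n_def norm_Pair real_sqrt_mult_self)
    have "\<alpha> y * (y - x) + \<beta> y * (g y - g x) = E y * ((y - x)\<^sup>2 + (g y - g x)\<^sup>2) / n y"
      by (simp add: \<alpha>_def \<beta>_def power2_eq_square add_divide_distrib distrib_left mult.assoc)
    also have "\<dots> = E y * n y" using n by (simp add: n2[symmetric])
    also have "\<dots> = w y - w x - ((y - x) * p + (g y - g x) * q)"
    proof -
      have "E y = (w y - w x - ((y - x) * p + (g y - g x) * q)) / n y"
        unfolding E_def r_def n_def fst_conv snd_conv elim(2) level0 by simp
      then show ?thesis using n by simp
    qed
    finally have eq: "(g y - g x) * (q + \<beta> y) = (w y - w x) - (p + \<alpha> y) * (y - x)"
      by (simp add: algebra_simps)
    have "(w y - w x) / (y - x) - (p + \<alpha> y) = (g y - g x) * (q + \<beta> y) / (y - x)"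
      unfolding eq using elim(3) by (simp add: diff_divide_distrib)
    then show ?case using elim(1) by simp
  qed
  then show ?thesis unfolding has_field_derivative_iff using Lim_transform_eventually[OF lim] by simp
qed

lemma compact_positive_lower_bound:
  fixes f :: "'a::topological_space \<Rightarrow> real"
  assumes "compact K" "continuous_on K f" "\<And>x. x \<in> K \<Longrightarrow> 0 < f x"
  shows "\<exists>c>0. \<forall>x\<in>K. c \<le> f x"
proof (cases "K = {}")
  case False
  then obtain x where "x \<in> K" "\<forall>y\<in>K. f x \<le> f y"
    using continuous_attains_inf[OF assms(1) _ assms(2)] by blast
  then show ?thesis using assms(3) by blast
qed (auto intro: exI[of _ 1])

lemma derivative_lower_bound_imp_growth:
  fixes f :: "real \<Rightarrow> real"
  assumes "a \<le> b" and "\<And>x. a \<le> x \<Longrightarrow> x \<le> b \<Longrightarrow> (f has_real_derivative f' x) (at x)"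
    and "\<And>x. a \<le> x \<Longrightarrow> x \<le> b \<Longrightarrow> c \<le> f' x"
  shows "f a + c * (b - a) \<le> f b"
proof (cases "a = b")
  case False
  then obtain z where "a < z" "z < b" "f b - f a = (b - a) * f' z"
    using MVT2[of a b f f'] assms by force
  then show ?thesis using assms(3)[of z] mult_left_mono[of c "f' z" "b - a"] by (simp add: algebra_simps)
qed auto

text \<open>
  This and the next lemma turn "the two curves meet only at the end" into "one curve stays above
  the other", for a known order at the other end.
\<close>

lemma nonvanishing_pos_left_imp_pos:
  fixes f :: "real \<Rightarrow> real"
  assumes "continuous_on {a..<b} f" "0 < f a" "\<And>x. a \<le> x \<Longrightarrow> x < b \<Longrightarrow> f x \<noteq> 0" "a \<le> x" "x < b"
  shows "0 < f x"
proof (rule ccontr)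
  assume "\<not> 0 < f x"
  moreover have "continuous_on {a..x} f" using assms by (auto intro: continuous_on_subset)
  ultimately have "\<exists>z\<ge>a. z \<le> x \<and> f z = 0" using IVT2'[of f x 0 a] assms by auto
  then show False using assms by force
qed

lemma nonvanishing_pos_right_imp_pos:
  fixes f :: "real \<Rightarrow> real"
  assumes "continuous_on {a<..b} f" "0 < f b" "\<And>x. a < x \<Longrightarrow> x \<le> b \<Longrightarrow> f x \<noteq> 0" "a < x" "x \<le> b"
  shows "0 < f x"
proof (rule ccontr)
  assume "\<not> 0 < f x"
  moreover have "continuous_on {x..b} f" using assms by (auto intro: continuous_on_subset)
  ultimately have "\<exists>z\<ge>x. z \<le> b \<and> f z = 0" using IVT'[of f x 0 b] assms by auto
  then show False using assms by force
qed

lemma strictly_monotone_cases: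
  fixes f :: "real \<Rightarrow> real"
  assumes "a < b" and "strict_mono_on {a..b} f \<or> strict_antimono_on {a..b} f"
  shows "(f a < f b \<and> (\<forall>k\<in>{a..b}. f a \<le> f k \<and> f k \<le> f b)) \<or>
         (f b < f a \<and> (\<forall>k\<in>{a..b}. f b \<le> f k \<and> f k \<le> f a))"
  using assms(2)
proof
  assume "strict_mono_on {a..b} f"
  then have "x \<in> {a..b} \<Longrightarrow> y \<in> {a..b} \<Longrightarrow> x < y \<Longrightarrow> f x < f y" for x y by (simp add: monotone_on_def)
  from this[of a b] this[of a] this[of _ b] show ?thesis
    using \<open>a < b\<close> by (metis atLeastAtMost_iff less_eq_real_def order_refl)
next
  assume "strict_antimono_on {a..b} f"
  then have "x \<in> {a..b} \<Longrightarrow> y \<in> {a..b} \<Longrightarrow> x < y \<Longrightarrow> f y < f x" for x y by (simp add: monotone_on_def)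
  from this[of a b] this[of a] this[of _ b] show ?thesis
    using \<open>a < b\<close> by (metis atLeastAtMost_iff less_eq_real_def order_refl)
qed

text \<open>
  A continuous injection of an interval into the line is a homeomorphism onto its image. In this
  way regularity known for the inverses \<open>hA\<close>, \<open>hD\<close> on one side of \<open>uc\<close> passes to \<open>uA\<close>, \<open>uD\<close>.
\<close>

lemma injective_branch:
  fixes f g :: "real \<Rightarrow> real"
  assumes S: "is_interval S" and g: "continuous_on S g" and inv: "\<And>x. x \<in> S \<Longrightarrow> f (g x) = x"
  shows "is_interval (g ` S)" and "continuous_on (g ` S) f"
    and "strict_mono_on (g ` S) f \<or> strict_antimono_on (g ` S) f"
    and "open S \<Longrightarrow> open (g ` S)"
proof -
  have inj: "inj_on g S" using inv by (metis inj_onI)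
  have "path_connected S" using S by (simp add: is_interval_path_connected_1)
  then obtain k where k: "homeomorphism S (g ` S) g k"
    using homeomorphism_into_1d[OF _ g refl inj] by blast
  then show c: "continuous_on (g ` S) f"
    by (auto simp: homeomorphism_def inv intro!: continuous_on_eq[of "g ` S" k])
  show i: "is_interval (g ` S)"
    using S g by (simp add: is_interval_connected_1 connected_continuous_image)
  have "inj_on f (g ` S)" by (auto intro!: inj_onI simp: inv)
  then show "strict_mono_on (g ` S) f \<or> strict_antimono_on (g ` S) f"
    using injective_eq_monotone_map[OF i c] by blast
  show "open S \<Longrightarrow> open (g ` S)"
    using injective_eq_1d_open_map_UNIV[OF g S] inj by blast
qed

text \<open>
  For a function already known to be strictly monotone, one pair of points decides the direction.
\<close>

lemma strict_mono_on_from_pair: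
  fixes f :: "real \<Rightarrow> real"
  assumes "strict_mono_on S f \<or> strict_antimono_on S f" "x \<in> S" "y \<in> S" "x < y" "f x < f y"
  shows "strict_mono_on S f"
  using assms monotone_onD[of S "(<)" "\<lambda>x y. y < x" f x y] by force

lemma strict_antimono_on_leD:
  fixes f :: "real \<Rightarrow> real"
  shows "strict_antimono_on S f \<Longrightarrow> x \<in> S \<Longrightarrow> y \<in> S \<Longrightarrow> x \<le> y \<Longrightarrow> f y \<le> f x"
  using monotone_onD[of S "(<)" "\<lambda>x y. y < x" f x y] by (cases "x = y") auto

lemma strict_antimono_on_from_pair:
  fixes f :: "real \<Rightarrow> real"
  assumes "strict_mono_on S f \<or> strict_antimono_on S f" "x \<in> S" "y \<in> S" "x < y" "f y < f x"
  shows "strict_antimono_on S f"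
  using assms monotone_onD[of S "(<)" "(<)" f x y] by force

lemma interval_segment_subset: "is_interval S \<Longrightarrow> x \<in> S \<Longrightarrow> y \<in> S \<Longrightarrow> {x..y} \<subseteq> S" for S :: "real set"
  by (meson atLeastAtMost_iff mem_is_interval_1_I subsetI)

lemma strictly_monotone_subset:
  "strict_mono_on S f \<or> strict_antimono_on S f \<Longrightarrow> T \<subseteq> S \<Longrightarrow> strict_mono_on T f \<or> strict_antimono_on T f"
  by (meson monotone_on_subset)

section \<open>The velocity curves\<close>

locale hysteresis_traffic =
  fixes M :: traffic_curves
  assumes acc_dec: "acc_dec_curves M" and scanning: "scanning_curves M"
    and standing: "standing_assumption M"
begin

lemma vA_smooth:
  "u0A M \<le> u \<Longrightarrow> (vA M has_real_derivative deriv (vA M) u) (at u)"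
  "continuous_on {u0A M..} (deriv (vA M))"
  using acc_dec smooth_around_real[of "vA M" "{u0A M..}"] by (auto simp: acc_dec_curves_def)

lemma vD_smooth:
  "1 \<le> u \<Longrightarrow> (vD M has_real_derivative deriv (vD M) u) (at u)"
  "continuous_on {1..} (deriv (vD M))"
  using acc_dec smooth_around_real[of "vD M" "{1..}"] by (auto simp: acc_dec_curves_def)

lemmas vS_smooth = smooth_around_plane[of "vS M" "Omega M"]

lemma vS_smooth_around: "smooth_around (\<lambda>(u, h). vS M u h) (Omega M)"
  using scanning by (simp add: scanning_curves_def)

lemma dom_ge_1: "h \<in> dom_uD M \<Longrightarrow> 1 \<le> h"
  using scanning by (auto simp: scanning_curves_def)

lemma uD_ge_1: "h \<in> dom_uD M \<Longrightarrow> 1 \<le> uD M h"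
  using scanning by (auto simp: scanning_curves_def bij_betw_def)

lemma OmegaI: "h \<in> dom_uD M \<Longrightarrow> uD M h \<le> u \<Longrightarrow> u \<le> uA M h \<Longrightarrow> (u, h) \<in> Omega M"
  using uD_ge_1[of h] by (simp add: Omega_def)

lemma OmegaD:
  assumes "(u, h) \<in> Omega M"
  shows "h \<in> dom_uD M" "uD M h \<le> u" "u \<le> uA M h" "1 \<le> u"
  using assms by (auto simp: Omega_def)

lemma uA_ge: "h \<in> dom_uD M \<Longrightarrow> u0A M \<le> uA M h"
  using scanning dom_ge_1[of h] by (auto simp: scanning_curves_def bij_betw_def)

lemma uD_le_uA: "h \<in> dom_uD M \<Longrightarrow> uD M h \<le> uA M h"
  using standing by (auto simp: standing_assumption_def)

lemma u0A_gt_1: "1 < u0A M"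
  using acc_dec by (simp add: acc_dec_curves_def)

lemma uc_gt_u0A: "u0A M < uc M"
proof -
  have *: "u0A M \<le> uc M" "vA M (u0A M) = 0" "vA M (uc M) = vD M (uc M)" "\<And>u. 1 < u \<Longrightarrow> 0 < vD M u"
    using acc_dec by (auto simp: acc_dec_curves_def)
  then show ?thesis using u0A_gt_1 by (cases "u0A M = uc M") (use *(4)[of "uc M"] in auto)
qed

lemma vA_strict:
  assumes "u0A M \<le> x" "x < y" shows "vA M x < vA M y"
proof (rule DERIV_pos_imp_increasing[OF assms(2)])
  fix z assume "x \<le> z" "z \<le> y"
  then show "\<exists>d. (vA M has_real_derivative d) (at z) \<and> 0 < d"
    using vA_smooth(1)[of z] standing assms(1) unfolding standing_assumption_def by (meson order_trans)
qed

lemma vD_strict: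
  assumes "1 \<le> x" "x < y" shows "vD M x < vD M y"
proof (rule DERIV_pos_imp_increasing[OF assms(2)])
  fix z assume "x \<le> z" "z \<le> y"
  then show "\<exists>d. (vD M has_real_derivative d) (at z) \<and> 0 < d"
    using vD_smooth(1)[of z] standing assms(1) unfolding standing_assumption_def by (meson order_trans)
qed

lemma vS_deriv_pos:
  assumes "(u, h) \<in> Omega M"
  shows "0 < deriv (\<lambda>x. vS M x h) u" "0 < deriv (vS M u) h"
  using standing assms by (auto simp: standing_assumption_def)

lemma vS_strict_spacing:
  assumes "(x, h) \<in> Omega M" "(y, h) \<in> Omega M" "x < y"
  shows "vS M x h < vS M y h"
proof (rule DERIV_pos_imp_increasing[OF assms(3)])
  fix z assume "x \<le> z" "z \<le> y"
  then have "(z, h) \<in> Omega M" using assms by (auto simp: Omega_def)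
  then show "\<exists>d. ((\<lambda>x. vS M x h) has_real_derivative d) (at z) \<and> 0 < d"
    using vS_smooth(4)[OF vS_smooth_around] vS_deriv_pos(1) by blast
qed

text \<open>
  Comparison of two scanning curves at the same spacing needs the whole segment between them inside
  \<open>Omega\<close>, since only there the sign of the derivative is given. Most of the work below is to
  guarantee this.
\<close>

lemma vS_strict_hysteresis:
  assumes "a < b" "\<And>h. a \<le> h \<Longrightarrow> h \<le> b \<Longrightarrow> (u, h) \<in> Omega M"
  shows "vS M u a < vS M u b"
proof (rule DERIV_pos_imp_increasing[OF assms(1)])
  fix z assume "a \<le> z" "z \<le> b"
  then have "(u, z) \<in> Omega M" using assms by auto
  then show "\<exists>d. (vS M u has_real_derivative d) (at z) \<and> 0 < d"
    using vS_smooth(5)[OF vS_smooth_around] vS_deriv_pos(2) by blast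
qed

lemma vA_cont: "continuous_on {u0A M..} (vA M)"
proof (rule continuous_at_imp_continuous_on, rule ballI)
  show "isCont (vA M) u" if "u \<in> {u0A M..}" for u
    using that by (intro DERIV_isCont[OF vA_smooth(1)]) simp
qed

lemma vD_cont: "continuous_on {1..} (vD M)"
proof (rule continuous_at_imp_continuous_on, rule ballI)
  show "isCont (vD M) u" if "u \<in> {1..}" for u
    using that by (intro DERIV_isCont[OF vD_smooth(1)]) simp
qed

lemma vS_cont_spacing:
  assumes "h \<in> dom_uD M" shows "continuous_on {uD M h..uA M h} (\<lambda>u. vS M u h)"
proof (rule continuous_at_imp_continuous_on, rule ballI)
  show "isCont (\<lambda>u. vS M u h) u" if "u \<in> {uD M h..uA M h}" for u
    using that OmegaI[OF assms, of u] by (intro DERIV_isCont[OF vS_smooth(4)[OF vS_smooth_around]]) simp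
qed

lemma vS_uA: "h \<in> dom_uD M \<Longrightarrow> vS M (uA M h) h = vA M (uA M h)"
  using scanning dom_ge_1 by (auto simp: scanning_curves_def)

lemma vS_uD: "h \<in> dom_uD M \<Longrightarrow> vS M (uD M h) h = vD M (uD M h)"
  using scanning by (auto simp: scanning_curves_def)

lemma vS_eq_vA: "(u, h) \<in> Omega M \<Longrightarrow> u0A M \<le> u \<Longrightarrow> vS M u h = vA M u \<Longrightarrow> u = uA M h"
  and vS_eq_vD: "(u, h) \<in> Omega M \<Longrightarrow> vS M u h = vD M u \<Longrightarrow> u = uD M h"
  using scanning by (auto simp: scanning_curves_def)

lemma vA_uc: "vA M (uc M) = vD M (uc M)"
  and vA_less_vD: "u0A M \<le> u \<Longrightarrow> u < uc M \<Longrightarrow> vA M u < vD M u"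
  and vD_less_vA: "uc M < u \<Longrightarrow> vD M u < vA M u"
  using acc_dec by (auto simp: acc_dec_curves_def)

lemma vD_nonneg: "1 \<le> u \<Longrightarrow> 0 \<le> vD M u"
  using acc_dec by (cases "u = 1") (simp_all add: acc_dec_curves_def less_imp_le)

section \<open>Position of a scanning curve relative to the two branches\<close>

text \<open>
  A scanning curve meets the acceleration curve only at \<open>uA h\<close>, so it keeps up to there the position
  that it has at its start on the deceleration curve. If the start lies to the left of \<open>u0A\<close>, the
  curves are compared at \<open>u0A\<close> instead, where \<open>vA\<close> vanishes and \<open>vS\<close> is already positive.
\<close>

lemma vS_above_vA:
  assumes h: "h \<in> dom_uD M" "uD M h < uc M" and u: "uD M h \<le> u" "u0A M \<le> u" "u < uA M h"
  shows "vA M u < vS M u h"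
proof -
  define a where "a = max (uD M h) (u0A M)"
  have a: "a < uA M h" "a < uc M" "uD M h \<le> a" "u0A M \<le> a" "a \<le> u"
    using assms uc_gt_u0A by (auto simp: a_def)
  have "vA M a < vS M a h"
  proof (cases "u0A M \<le> uD M h")
    case True
    then show ?thesis using vA_less_vD[of a] a h by (simp add: a_def vS_uD)
  next
    case False
    then have eq: "a = u0A M" by (simp add: a_def)
    have "0 \<le> vS M (uD M h) h" using vS_uD vD_nonneg uD_ge_1 h by simp
    also have "\<dots> < vS M a h" using False eq a h by (intro vS_strict_spacing OmegaI) auto
    finally show ?thesis using acc_dec eq by (simp add: acc_dec_curves_def)
  qed
  moreover have "continuous_on {a..<uA M h} (\<lambda>u. vS M u h - vA M u)"
    using a by (intro continuous_intros continuous_on_subset[OF vS_cont_spacing[OF h(1)]]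
        continuous_on_subset[OF vA_cont]) auto
  moreover have "vS M x h - vA M x \<noteq> 0" if "a \<le> x" "x < uA M h" for x
    using vS_eq_vA[OF OmegaI[OF h(1), of x]] that a by auto
  ultimately show ?thesis
    using nonvanishing_pos_left_imp_pos[of a "uA M h" "\<lambda>u. vS M u h - vA M u" u] a u by auto
qed

lemma vS_below_vA:
  assumes h: "h \<in> dom_uD M" "uc M < uD M h" and u: "uD M h \<le> u" "u < uA M h"
  shows "vS M u h < vA M u"
proof -
  have "continuous_on {uD M h..<uA M h} (\<lambda>u. vA M u - vS M u h)"
    using h uc_gt_u0A by (intro continuous_intros continuous_on_subset[OF vS_cont_spacing[OF h(1)]]
        continuous_on_subset[OF vA_cont]) auto
  moreover have "vA M x - vS M x h \<noteq> 0" if "uD M h \<le> x" "x < uA M h" for x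
    using vS_eq_vA[OF OmegaI[OF h(1), of x]] that h uc_gt_u0A by auto
  moreover have "vS M (uD M h) h < vA M (uD M h)" using vD_less_vA h vS_uD by simp
  ultimately show ?thesis
    using nonvanishing_pos_left_imp_pos[of "uD M h" "uA M h" "\<lambda>u. vA M u - vS M u h" u] u by auto
qed

text \<open>
  In the same way the position relative to the deceleration curve is read off at the end point
  \<open>uA h\<close>, where \<open>vS\<close> agrees with \<open>vA\<close>.
\<close>

lemma vS_below_vD:
  assumes h: "h \<in> dom_uD M" "uA M h < uc M" and u: "uD M h < u" "u \<le> uA M h"
  shows "vS M u h < vD M u"
proof -
  have "continuous_on {uD M h<..uA M h} (\<lambda>u. vD M u - vS M u h)"
    using uD_ge_1[OF h(1)] by (intro continuous_intros continuous_on_subset[OF vS_cont_spacing[OF h(1)]]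
        continuous_on_subset[OF vD_cont]) auto
  moreover have "vD M x - vS M x h \<noteq> 0" if "uD M h < x" "x \<le> uA M h" for x
    using vS_eq_vD[OF OmegaI[OF h(1), of x]] that by auto
  moreover have "vS M (uA M h) h < vD M (uA M h)" using vA_less_vD h vS_uA uA_ge by simp
  ultimately show ?thesis
    using nonvanishing_pos_right_imp_pos[of "uD M h" "uA M h" "\<lambda>u. vD M u - vS M u h" u] u by auto
qed

lemma vS_above_vD:
  assumes h: "h \<in> dom_uD M" "uc M < uA M h" and u: "uD M h < u" "u \<le> uA M h"
  shows "vD M u < vS M u h"
proof -
  have "continuous_on {uD M h<..uA M h} (\<lambda>u. vS M u h - vD M u)"
    using uD_ge_1[OF h(1)] by (intro continuous_intros continuous_on_subset[OF vS_cont_spacing[OF h(1)]]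
        continuous_on_subset[OF vD_cont]) auto
  moreover have "vS M x h - vD M x \<noteq> 0" if "uD M h < x" "x \<le> uA M h" for x
    using vS_eq_vD[OF OmegaI[OF h(1), of x]] that by auto
  moreover have "vD M (uA M h) < vS M (uA M h) h" using vD_less_vA h vS_uA by simp
  ultimately show ?thesis
    using nonvanishing_pos_right_imp_pos[of "uD M h" "uA M h" "\<lambda>u. vS M u h - vD M u" u] u by auto
qed

section \<open>Congested and free scanning curves\<close>

text \<open>
  On such an interval every scanning curve starts to the left of the end of every other. At a
  spacing \<open>uA l\<close> the vertical segment over the interval can therefore leave \<open>Omega\<close> only through the
  acceleration curve, at \<open>uD l\<close> only through the deceleration curve; monotonicity of \<open>uA\<close> or \<open>uD\<close>
  rules this out for one end \<open>l\<close> of the interval, so that \<open>vS_strict_hysteresis\<close> applies.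
\<close>

definition narrow :: "real \<Rightarrow> real \<Rightarrow> bool" where
  "narrow a b \<longleftrightarrow> a < b \<and> {a..b} \<subseteq> dom_uD M \<and> (\<forall>k\<in>{a..b}. \<forall>l\<in>{a..b}. uD M k < uA M l)"

lemma narrow_D:
  assumes "narrow a b"
  shows "a < b" "a \<in> dom_uD M" "b \<in> dom_uD M"
    "\<And>k. a \<le> k \<Longrightarrow> k \<le> b \<Longrightarrow> k \<in> dom_uD M"
    "\<And>k l. a \<le> k \<Longrightarrow> k \<le> b \<Longrightarrow> a \<le> l \<Longrightarrow> l \<le> b \<Longrightarrow> uD M k < uA M l"
  using assms by (auto simp: narrow_def subset_iff)

text \<open>
  The direction in which \<open>uA\<close> moves is dictated by the side from which the scanning curves approach
  the acceleration curve. If they come from above and \<open>uA b < uA a\<close>, then at the spacing \<open>uA b\<close> the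
  curve of \<open>a\<close> is still above the acceleration curve, that is, above the curve of \<open>b\<close>, although
  \<open>a < b\<close>. The other case is symmetric.
\<close>

lemma uA_directions:
  assumes n: "narrow a b"
    and d: "strict_mono_on {a..b} (uA M) \<or> strict_antimono_on {a..b} (uA M)"
  shows "uD M a < uc M \<Longrightarrow> uA M a < uA M b"
    and "uc M < uD M b \<Longrightarrow> uA M b < uA M a"
proof -
  note n' = narrow_D[OF n]
  note cs = strictly_monotone_cases[OF n'(1) d]
  show "uA M a < uA M b" if c: "uD M a < uc M"
  proof (rule ccontr)
    assume "\<not> uA M a < uA M b"
    then have ba: "uA M b < uA M a" and min: "\<And>k. a \<le> k \<Longrightarrow> k \<le> b \<Longrightarrow> uA M b \<le> uA M k"
      using cs by auto
    have "vS M (uA M b) a < vS M (uA M b) b"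
      by (rule vS_strict_hysteresis[OF n'(1)], rule OmegaI[OF n'(4)])
        (use n'(1) in \<open>auto intro!: less_imp_le[OF n'(5)] min\<close>)
    moreover have "vA M (uA M b) < vS M (uA M b) a"
      using n'(5)[of a b] n'(1) by (intro vS_above_vA[OF n'(2) c] ba uA_ge n'(3)) simp
    ultimately show False using vS_uA[OF n'(3)] by simp
  qed
  show "uA M b < uA M a" if c: "uc M < uD M b"
  proof (rule ccontr)
    assume "\<not> uA M b < uA M a"
    then have ab: "uA M a < uA M b" and min: "\<And>k. a \<le> k \<Longrightarrow> k \<le> b \<Longrightarrow> uA M a \<le> uA M k"
      using cs by auto
    have "vS M (uA M a) a < vS M (uA M a) b"
      by (rule vS_strict_hysteresis[OF n'(1)], rule OmegaI[OF n'(4)])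
        (use n'(1) in \<open>auto intro!: less_imp_le[OF n'(5)] min\<close>)
    moreover have "vS M (uA M a) b < vA M (uA M a)"
      using n'(5)[of b a] n'(1) by (intro vS_below_vA[OF n'(3) c] ab) simp
    ultimately show False using vS_uA[OF n'(2)] by simp
  qed
qed

text \<open>
  Along the deceleration curve the side to which a scanning curve leaves it decides in the same way;
  this side is read off from the zone in which the curve ends.
\<close>

lemma uD_directions:
  assumes n: "narrow a b"
    and d: "strict_mono_on {a..b} (uD M) \<or> strict_antimono_on {a..b} (uD M)"
  shows "uA M b < uc M \<Longrightarrow> uD M a < uD M b"
    and "uc M < uA M a \<Longrightarrow> uD M b < uD M a"
proof -
  note n' = narrow_D[OF n]
  note cs = strictly_monotone_cases[OF n'(1) d]
  show "uD M a < uD M b" if c: "uA M b < uc M"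
  proof (rule ccontr)
    assume "\<not> uD M a < uD M b"
    then have ba: "uD M b < uD M a" and max: "\<And>k. a \<le> k \<Longrightarrow> k \<le> b \<Longrightarrow> uD M k \<le> uD M a"
      using cs by auto
    have "vS M (uD M a) a < vS M (uD M a) b"
      by (rule vS_strict_hysteresis[OF n'(1)], rule OmegaI[OF n'(4)])
        (use n'(1) in \<open>auto intro!: less_imp_le[OF n'(5)] max\<close>)
    moreover have "vS M (uD M a) b < vD M (uD M a)"
      using n'(5)[of a b] n'(1) by (intro vS_below_vD[OF n'(3) c] ba) simp
    ultimately show False using vS_uD[OF n'(2)] by simp
  qed
  show "uD M b < uD M a" if c: "uc M < uA M a"
  proof (rule ccontr)
    assume "\<not> uD M b < uD M a"
    then have ab: "uD M a < uD M b" and max: "\<And>k. a \<le> k \<Longrightarrow> k \<le> b \<Longrightarrow> uD M k \<le> uD M b"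
      using cs by auto
    have "vS M (uD M b) a < vS M (uD M b) b"
      by (rule vS_strict_hysteresis[OF n'(1)], rule OmegaI[OF n'(4)])
        (use n'(1) in \<open>auto intro!: less_imp_le[OF n'(5)] max\<close>)
    moreover have "vD M (uD M b) < vS M (uD M b) a"
      using n'(5)[of b a] n'(1) by (intro vS_above_vD[OF n'(2) c] ab) simp
    ultimately show False using vS_uD[OF n'(3)] by simp
  qed
qed

lemma hD_inverse:
  "h \<in> dom_uD M \<Longrightarrow> hD M (uD M h) = h" "1 \<le> u \<Longrightarrow> uD M (hD M u) = u" "1 \<le> u \<Longrightarrow> hD M u \<in> dom_uD M"
proof -
  have b: "bij_betw (uD M) (dom_uD M) {1..}" using scanning by (simp add: scanning_curves_def)
  show "h \<in> dom_uD M \<Longrightarrow> hD M (uD M h) = h"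
    using b by (simp add: hD_def the_inv_into_f_f bij_betw_def)
  show "1 \<le> u \<Longrightarrow> uD M (hD M u) = u"
    using b f_the_inv_into_f_bij_betw[OF b, of u] by (simp add: hD_def)
  show "1 \<le> u \<Longrightarrow> hD M u \<in> dom_uD M"
    using bij_betw_the_inv_into[OF b] by (auto simp: hD_def bij_betw_def)
qed

lemma hA_inverse:
  "1 \<le> h \<Longrightarrow> hA M (uA M h) = h" "u0A M \<le> u \<Longrightarrow> uA M (hA M u) = u" "u0A M \<le> u \<Longrightarrow> 1 \<le> hA M u"
proof -
  have b: "bij_betw (uA M) {1..} {u0A M..}" using scanning by (simp add: scanning_curves_def)
  show "1 \<le> h \<Longrightarrow> hA M (uA M h) = h"
    using b by (simp add: hA_def the_inv_into_f_f bij_betw_def)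
  show "u0A M \<le> u \<Longrightarrow> uA M (hA M u) = u"
    using b f_the_inv_into_f_bij_betw[OF b, of u] by (simp add: hA_def)
  show "u0A M \<le> u \<Longrightarrow> 1 \<le> hA M u"
    using bij_betw_the_inv_into[OF b] by (auto simp: hA_def bij_betw_def)
qed

lemma hc_eq: "hc M = hA M (uc M)" "hc M = hD M (uc M)"
  using scanning by (auto simp: hc_def scanning_curves_def)

lemma uD_eq_uc_iff: "h \<in> dom_uD M \<Longrightarrow> uD M h = uc M \<longleftrightarrow> h = hc M"
  using hD_inverse(1)[of h] hD_inverse(2)[of "uc M"] uc_gt_u0A u0A_gt_1 by (auto simp: hc_eq(2))

lemma uA_eq_uc_iff: "1 \<le> h \<Longrightarrow> uA M h = uc M \<longleftrightarrow> h = hc M"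
  using hA_inverse(1)[of h] hA_inverse(2)[of "uc M"] uc_gt_u0A by (auto simp: hc_eq(1))

lemma uD_less_uA: "h \<in> dom_uD M \<Longrightarrow> h \<noteq> hc M \<Longrightarrow> uD M h < uA M h"
  using standing by (force simp: standing_assumption_def order_less_le)

text \<open>
  A scanning curve is classified by its starting point on the deceleration curve;
  \<open>congested_uA\<close> and \<open>free_uA\<close> show that its end point lies on the same side of \<open>uc\<close>.
\<close>

definition congested :: "real set" where
  "congested = {h \<in> dom_uD M. uD M h < uc M}"

definition free :: "real set" where
  "free = {h \<in> dom_uD M. uc M < uD M h}"

lemma zone_split: "h \<in> dom_uD M \<Longrightarrow> h \<in> congested \<or> h \<in> free \<or> h = hc M"
  using uD_eq_uc_iff[of h] by (auto simp: congested_def free_def)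

lemma not_hc: "h \<in> congested \<or> h \<in> free \<Longrightarrow> h \<noteq> hc M"
  using uD_eq_uc_iff[of h] by (auto simp: congested_def free_def)

lemma congested_eq: "congested = hD M ` {1..<uc M}"
proof (intro equalityI subsetI)
  fix h assume "h \<in> congested"
  then have "h = hD M (uD M h)" "uD M h \<in> {1..<uc M}"
    using hD_inverse(1) uD_ge_1 by (auto simp: congested_def)
  then show "h \<in> hD M ` {1..<uc M}" by blast
next
  fix h assume "h \<in> hD M ` {1..<uc M}"
  then show "h \<in> congested" using hD_inverse by (auto simp: congested_def)
qed

lemma free_eq: "free = hD M ` {uc M<..}"
proof (intro equalityI subsetI)
  fix h assume "h \<in> free"
  then have "h = hD M (uD M h)" "uD M h \<in> {uc M<..}"
    using hD_inverse(1) by (auto simp: free_def)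
  then show "h \<in> hD M ` {uc M<..}" by blast
next
  fix h assume "h \<in> hD M ` {uc M<..}"
  then show "h \<in> free" using hD_inverse uc_gt_u0A u0A_gt_1 by (auto simp: free_def)
qed

lemma uA_below_eq: "{h. 1 \<le> h \<and> uA M h < uc M} = hA M ` {u0A M..<uc M}"
proof (intro equalityI subsetI)
  fix h assume h: "h \<in> {h. 1 \<le> h \<and> uA M h < uc M}"
  moreover have "u0A M \<le> uA M h" using scanning h by (auto simp: scanning_curves_def bij_betw_def)
  ultimately have "h = hA M (uA M h)" "uA M h \<in> {u0A M..<uc M}"
    using hA_inverse(1) by auto
  then show "h \<in> hA M ` {u0A M..<uc M}" by blast
next
  fix h assume "h \<in> hA M ` {u0A M..<uc M}"
  then show "h \<in> {h. 1 \<le> h \<and> uA M h < uc M}" using hA_inverse by auto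
qed

lemma uA_above_eq: "{h. 1 \<le> h \<and> uc M < uA M h} = hA M ` {uc M<..}"
proof (intro equalityI subsetI)
  fix h assume h: "h \<in> {h. 1 \<le> h \<and> uc M < uA M h}"
  then have "h = hA M (uA M h)" "uA M h \<in> {uc M<..}"
    using hA_inverse(1) by auto
  then show "h \<in> hA M ` {uc M<..}" by blast
next
  fix h assume "h \<in> hA M ` {uc M<..}"
  then show "h \<in> {h. 1 \<le> h \<and> uc M < uA M h}" using hA_inverse uc_gt_u0A by auto
qed

lemma inverse_cont:
  "continuous_on {1..<uc M} (hD M)" "continuous_on {uc M<..} (hD M)"
  "continuous_on {u0A M..<uc M} (hA M)" "continuous_on {uc M<..} (hA M)"
proof -
  have c: "continuous_on ({u0A M..} - {uc M}) (hA M)" "continuous_on ({1..} - {uc M}) (hD M)"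
    using scanning by (auto simp: scanning_curves_def)
  show "continuous_on {1..<uc M} (hD M)" by (rule continuous_on_subset[OF c(2)]) auto
  show "continuous_on {uc M<..} (hD M)"
    by (rule continuous_on_subset[OF c(2)]) (use uc_gt_u0A u0A_gt_1 in auto)
  show "continuous_on {u0A M..<uc M} (hA M)" by (rule continuous_on_subset[OF c(1)]) auto
  show "continuous_on {uc M<..} (hA M)"
    by (rule continuous_on_subset[OF c(1)]) (use uc_gt_u0A in auto)
qed

lemma congested_branch:
  "is_interval congested"
  "continuous_on congested (uD M)"
  "strict_mono_on congested (uD M) \<or> strict_antimono_on congested (uD M)"
proof -
  have i: "is_interval {1..<uc M}" by (simp add: is_interval_convex_1)
  have inv: "uD M (hD M x) = x" if "x \<in> {1..<uc M}" for x
    using that uc_gt_u0A u0A_gt_1 by (intro hD_inverse(2)) auto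
  note b = injective_branch[of _ _ "uD M", OF i inverse_cont(1) inv, folded congested_eq]
  show "is_interval congested" by (rule b(1))
  show "continuous_on congested (uD M)" by (rule b(2))
  show "strict_mono_on congested (uD M) \<or> strict_antimono_on congested (uD M)" by (rule b(3))
qed

lemma free_branch:
  "is_interval free"
  "continuous_on free (uD M)"
  "strict_mono_on free (uD M) \<or> strict_antimono_on free (uD M)"
proof -
  have i: "is_interval {uc M<..}" by (simp add: is_interval_convex_1)
  have inv: "uD M (hD M x) = x" if "x \<in> {uc M<..}" for x
    using that uc_gt_u0A u0A_gt_1 by (intro hD_inverse(2)) auto
  note b = injective_branch[of _ _ "uD M", OF i inverse_cont(2) inv, folded free_eq]
  show "is_interval free" by (rule b(1))
  show "continuous_on free (uD M)" by (rule b(2))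
  show "strict_mono_on free (uD M) \<or> strict_antimono_on free (uD M)" by (rule b(3))
qed

lemma uA_below_branch:
  "continuous_on {h. 1 \<le> h \<and> uA M h < uc M} (uA M)"
  "strict_mono_on {h. 1 \<le> h \<and> uA M h < uc M} (uA M) \<or> strict_antimono_on {h. 1 \<le> h \<and> uA M h < uc M} (uA M)"
proof -
  have i: "is_interval {u0A M..<uc M}" by (simp add: is_interval_convex_1)
  have inv: "uA M (hA M x) = x" if "x \<in> {u0A M..<uc M}" for x
    using that uc_gt_u0A u0A_gt_1 by (intro hA_inverse(2)) auto
  note b = injective_branch[of _ _ "uA M", OF i inverse_cont(3) inv, folded uA_below_eq]
  show "continuous_on {h. 1 \<le> h \<and> uA M h < uc M} (uA M)" by (rule b(2))
  show "strict_mono_on {h. 1 \<le> h \<and> uA M h < uc M} (uA M) \<or> strict_antimono_on {h. 1 \<le> h \<and> uA M h < uc M} (uA M)" by (rule b(3))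
qed

lemma uA_above_branch:
  "continuous_on {h. 1 \<le> h \<and> uc M < uA M h} (uA M)"
  "strict_mono_on {h. 1 \<le> h \<and> uc M < uA M h} (uA M) \<or> strict_antimono_on {h. 1 \<le> h \<and> uc M < uA M h} (uA M)"
  "open {h. 1 \<le> h \<and> uc M < uA M h}"
proof -
  have i: "is_interval {uc M<..}" by (simp add: is_interval_convex_1)
  have inv: "uA M (hA M x) = x" if "x \<in> {uc M<..}" for x
    using that uc_gt_u0A u0A_gt_1 by (intro hA_inverse(2)) auto
  note b = injective_branch[of _ _ "uA M", OF i inverse_cont(4) inv, folded uA_above_eq]
  show "continuous_on {h. 1 \<le> h \<and> uc M < uA M h} (uA M)" by (rule b(2))
  show "strict_mono_on {h. 1 \<le> h \<and> uc M < uA M h} (uA M) \<or> strict_antimono_on {h. 1 \<le> h \<and> uc M < uA M h} (uA M)" by (rule b(3))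
  show "open {h. 1 \<le> h \<and> uc M < uA M h}" by (rule b(4)) simp_all
qed

text \<open>
  At \<open>x\<close> the two end points of the scanning curve are a positive distance apart, and by continuity
  a number that separates them there separates them on a whole interval.
\<close>

lemma narrow_exists:
  assumes xy: "x < y" "{x..y} \<subseteq> dom_uD M" and c: "continuous_on {x..y} (uD M)" "continuous_on {x..y} (uA M)"
    and x: "uD M x < uA M x"
  shows "\<exists>b. x < b \<and> b \<le> y \<and> narrow x b"
proof -
  define m where "m = (uD M x + uA M x) / 2"
  have m: "uD M x < m" "m < uA M x" using x by (auto simp: m_def)
  have "(uD M \<longlongrightarrow> uD M x) (at x within {x..y})" "(uA M \<longlongrightarrow> uA M x) (at x within {x..y})"
    using c xy(1) by (auto simp: continuous_on_def)
  then have "\<forall>\<^sub>F h in at x within {x..y}. uD M h < m \<and> m < uA M h"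
    using m by (intro eventually_conj order_tendstoD) auto
  then obtain d where d: "d > 0" "\<And>h. h \<in> {x..y} \<Longrightarrow> h \<noteq> x \<Longrightarrow> dist h x < d \<Longrightarrow> uD M h < m \<and> m < uA M h"
    unfolding eventually_at by blast
  define b where "b = min y (x + d / 2)"
  have b: "x < b" "b \<le> y" using d(1) xy(1) by (auto simp: b_def)
  have "uD M h < m \<and> m < uA M h" if "h \<in> {x..b}" for h
    using d(2)[of h] m that b d(1) by (cases "h = x") (auto simp: dist_real_def b_def)
  then have "uD M k < uA M l" if "k \<in> {x..b}" "l \<in> {x..b}" for k l
    using that by (meson less_trans)
  then have "narrow x b" unfolding narrow_def using b xy(2) by auto
  then show ?thesis using b by blast
qed

lemma free_uA: "h \<in> free \<Longrightarrow> 1 \<le> h \<and> uc M < uA M h"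
  using uD_le_uA[of h] dom_ge_1 by (auto simp: free_def)

lemma free_two_points: "\<exists>x y. x < y \<and> x \<in> free \<and> y \<in> free"
proof -
  have "hD M (uc M + 1) \<in> free" "hD M (uc M + 2) \<in> free" by (auto simp: free_eq)
  moreover have "hD M (uc M + 1) \<noteq> hD M (uc M + 2)"
    using hD_inverse(2)[of "uc M + 1"] hD_inverse(2)[of "uc M + 2"] uc_gt_u0A u0A_gt_1 by force
  ultimately show ?thesis by (metis linorder_neqE)
qed

lemma congested_two_points:
  assumes "h \<in> congested" shows "\<exists>x\<in>congested. x \<noteq> h"
proof -
  have u: "1 < uc M" using uc_gt_u0A u0A_gt_1 by simp
  have "hD M 1 \<in> congested" "hD M ((1 + uc M) / 2) \<in> congested" using u by (auto simp: congested_eq)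
  moreover have "hD M 1 \<noteq> hD M ((1 + uc M) / 2)"
    using hD_inverse(2)[of 1] hD_inverse(2)[of "(1 + uc M) / 2"] u by force
  ultimately show ?thesis by metis
qed

lemma free_narrow: "\<exists>x b. narrow x b \<and> {x..b} \<subseteq> free"
proof -
  obtain x y where xy: "x < y" "x \<in> free" "y \<in> free" using free_two_points by blast
  have sub: "{x..y} \<subseteq> free" using interval_segment_subset[OF free_branch(1)] xy by blast
  have "continuous_on {x..y} (uD M)" by (rule continuous_on_subset[OF free_branch(2) sub])
  moreover have "continuous_on {x..y} (uA M)"
    by (rule continuous_on_subset[OF uA_above_branch(1)]) (use sub free_uA in auto)
  moreover have "{x..y} \<subseteq> dom_uD M" using sub by (auto simp: free_def)
  moreover have "uD M x < uA M x" using xy not_hc uD_less_uA by (auto simp: free_def)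
  ultimately obtain b where "x < b" "b \<le> y" "narrow x b"
    using narrow_exists[OF xy(1)] by blast
  then show ?thesis using sub by fastforce
qed

text \<open>
  Free scanning curves cross both branches upwards, so both intersections move to
  the left when \<open>h\<close> increases. A narrow interval shows this for one pair of curves, and the branch
  is monotone. The third claim is about all curves that end to the right of \<open>uc\<close>, wherever they
  start.
\<close>

lemma free_strict_antimono: "strict_antimono_on free (uA M)" "strict_antimono_on free (uD M)"
  and uA_above_antimono: "strict_antimono_on {h. 1 \<le> h \<and> uc M < uA M h} (uA M)"
proof -
  obtain x b where n: "narrow x b" and sub: "{x..b} \<subseteq> free" using free_narrow by blast
  note n' = narrow_D[OF n]
  have xb: "x \<in> free" "b \<in> free" using sub n'(1) by auto
  have sub': "free \<subseteq> {h. 1 \<le> h \<and> uc M < uA M h}" using free_uA by auto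
  have "uA M b < uA M x"
    using uA_directions(2)[OF n strictly_monotone_subset[OF uA_above_branch(2)]] sub sub' xb
    by (auto simp: free_def)
  then show *: "strict_antimono_on {h. 1 \<le> h \<and> uc M < uA M h} (uA M)"
    using strict_antimono_on_from_pair[OF uA_above_branch(2) _ _ n'(1)] xb sub' by blast
  then show "strict_antimono_on free (uA M)" using sub' monotone_on_subset by blast
  have "uD M b < uD M x"
    using uD_directions(2)[OF n strictly_monotone_subset[OF free_branch(3) sub]] xb free_uA by blast
  then show "strict_antimono_on free (uD M)"
    by (rule strict_antimono_on_from_pair[OF free_branch(3) xb n'(1)])
qed

text \<open>
  A curve that started to the left and ended to the right of \<open>uc\<close> would reach the acceleration curve
  from above, so that \<open>uA\<close> would increase near it. But \<open>uA\<close> decreases among all curves that end to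
  the right of \<open>uc\<close>, because the free curves force this direction on the whole branch.
\<close>

lemma congested_uA: assumes h: "h \<in> congested" shows "1 \<le> h \<and> uA M h < uc M"
proof -
  have h1: "1 \<le> h" using h dom_ge_1 by (auto simp: congested_def)
  have "uA M h < uc M"
  proof (rule ccontr)
    let ?A = "{h. 1 \<le> h \<and> uc M < uA M h}"
    assume "\<not> uA M h < uc M"
    then have hA: "h \<in> ?A" using uA_eq_uc_iff[OF h1] not_hc h h1 by auto
    then obtain e where e: "e > 0" "ball h e \<subseteq> ?A" using uA_above_branch(3) open_contains_ball by blast
    obtain h' where h': "h' \<in> congested" "h' \<noteq> h" using congested_two_points[OF h] by blast
    \<comment> \<open>\<open>h\<close> may be an end point of the interval \<open>congested\<close>, so the segment extends towards \<open>h'\<close>.\<close>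
    have "\<exists>x y. x < y \<and> {x..y} \<subseteq> congested \<inter> ?A"
    proof (cases "h < h'")
      case True
      have "{h..min h' (h + e / 2)} \<subseteq> congested" using interval_segment_subset[OF congested_branch(1) h h'(1)] by auto
      moreover have "{h..min h' (h + e / 2)} \<subseteq> ball h e" using e(1) by (auto simp: dist_real_def)
      ultimately show ?thesis using e True by (intro exI[of _ h] exI[of _ "min h' (h + e / 2)"]) auto
    next
      case False
      have "{max h' (h - e / 2)..h} \<subseteq> congested" using interval_segment_subset[OF congested_branch(1) h'(1) h] by auto
      moreover have "{max h' (h - e / 2)..h} \<subseteq> ball h e" using e(1) by (auto simp: dist_real_def)
      ultimately show ?thesis using e False h' by (intro exI[of _ "max h' (h - e / 2)"] exI[of _ h]) auto
    qed
    then obtain x y where xy: "x < y" "{x..y} \<subseteq> congested" "{x..y} \<subseteq> ?A" by blast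
    have "uD M k < uA M l" if "k \<in> {x..y}" "l \<in> {x..y}" for k l
      using that xy(2,3) by (force simp: congested_def)
    then have "narrow x y" unfolding narrow_def using xy by (auto simp: congested_def)
    then have "uA M x < uA M y"
      using uA_directions(1)[OF _ strictly_monotone_subset[OF uA_above_branch(2) xy(3)]] xy(1)
        subsetD[OF xy(2), of x] by (simp add: congested_def)
    moreover have "uA M y < uA M x"
      by (rule monotone_onD[OF uA_above_antimono _ _ xy(1)]; rule subsetD[OF xy(3)]) (use xy(1) in auto)
    ultimately show False by simp
  qed
  then show ?thesis using h1 by simp
qed

lemma congested_strict_mono: "strict_mono_on congested (uA M)" "strict_mono_on congested (uD M)"
proof -
  let ?B = "{h. 1 \<le> h \<and> uA M h < uc M}"
  have sub': "congested \<subseteq> ?B" using congested_uA by auto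
  have "hD M 1 \<in> congested" using uc_gt_u0A u0A_gt_1 by (auto simp: congested_eq)
  then obtain x y where xy: "x < y" "x \<in> congested" "y \<in> congested"
    using congested_two_points by (metis linorder_neqE)
  have sub: "{x..y} \<subseteq> congested" using interval_segment_subset[OF congested_branch(1)] xy by blast
  have "continuous_on {x..y} (uD M)" by (rule continuous_on_subset[OF congested_branch(2) sub])
  moreover have "continuous_on {x..y} (uA M)"
    by (rule continuous_on_subset[OF uA_below_branch(1)]) (use sub sub' in auto)
  moreover have "{x..y} \<subseteq> dom_uD M" using sub by (auto simp: congested_def)
  moreover have "uD M x < uA M x" using xy not_hc uD_less_uA by (auto simp: congested_def)
  ultimately obtain b where b: "x < b" "b \<le> y" "narrow x b"
    using narrow_exists[OF xy(1)] by blast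
  have sub2: "{x..b} \<subseteq> congested" using sub b by auto
  then have xb: "x \<in> congested" "b \<in> congested" using b by auto
  have "uA M x < uA M b"
    using uA_directions(1)[OF b(3) strictly_monotone_subset[OF uA_below_branch(2)]] sub2 sub' xb
    by (auto simp: congested_def)
  then have "strict_mono_on ?B (uA M)"
    using strict_mono_on_from_pair[OF uA_below_branch(2) _ _ b(1)] xb sub' by blast
  then show "strict_mono_on congested (uA M)" using sub' monotone_on_subset by blast
  have "uD M x < uD M b"
    using uD_directions(1)[OF b(3) strictly_monotone_subset[OF congested_branch(3) sub2]] xb congested_uA by blast
  then show "strict_mono_on congested (uD M)"
    by (rule strict_mono_on_from_pair[OF congested_branch(3) xb b(1)])
qed

section \<open>Two states with the same velocity\<close>

lemma velocity_Omega: "(u, h) \<in> Omega M \<Longrightarrow> velocity M u h = vS M u h"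
  using vS_uD[of h] vS_uA[of h] OmegaD[of u h] unfolding velocity_def
  by (cases "u = uD M h"; cases "u = uA M h") auto

text \<open>
  The common value of the two branches at \<open>uc\<close> separates the velocities in the congested zone from
  those in the free zone, so states of equal velocity and different spacing belong to the same zone.
\<close>

lemma velocity_zone:
  assumes o: "(u, h) \<in> Omega M"
  shows "h \<in> congested \<Longrightarrow> vS M u h < vA M (uc M)" and "h \<in> free \<Longrightarrow> vA M (uc M) < vS M u h"
    and "h = hc M \<Longrightarrow> u = uc M"
proof -
  note d = OmegaD[OF o]
  show "vS M u h < vA M (uc M)" if "h \<in> congested"
  proof -
    have "vS M u h \<le> vA M (uA M h)"
      using vS_strict_spacing[OF o OmegaI[OF d(1) uD_le_uA[OF d(1)] order_refl]] d vS_uA[OF d(1)]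
      by (cases "u = uA M h") auto
    also have "\<dots> < vA M (uc M)" using congested_uA[OF that] uA_ge[OF d(1)] by (intro vA_strict) auto
    finally show ?thesis .
  qed
  show "vA M (uc M) < vS M u h" if "h \<in> free"
  proof -
    have "vA M (uc M) < vD M (uD M h)"
      unfolding vA_uc using that uc_gt_u0A u0A_gt_1 by (intro vD_strict) (auto simp: free_def)
    also have "\<dots> \<le> vS M u h"
      using vS_strict_spacing[OF OmegaI[OF d(1) order_refl uD_le_uA[OF d(1)]] o] d vS_uD[OF d(1)]
      by (cases "u = uD M h") auto
    finally show ?thesis .
  qed
  show "u = uc M" if "h = hc M"
    using d uD_eq_uc_iff[OF d(1)] uA_eq_uc_iff[OF dom_ge_1[OF d(1)]] that by auto
qed

lemma same_zone:
  assumes "(u1, h1) \<in> Omega M" "(u2, h2) \<in> Omega M" "u1 \<noteq> u2" "vS M u1 h1 = vS M u2 h2"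
  shows "(h1 \<in> congested \<and> h2 \<in> congested) \<or> (h1 \<in> free \<and> h2 \<in> free)"
proof -
  have "h \<in> congested \<and> vS M u h < vA M (uc M) \<or> h \<in> free \<and> vA M (uc M) < vS M u h \<or>
     vS M u h = vA M (uc M) \<and> u = uc M" if "(u, h) \<in> Omega M" for u h
  proof (cases "h = hc M")
    case True
    have d: "h \<in> dom_uD M" using that by (rule OmegaD)
    have "u = uc M" "uA M h = uc M"
      using velocity_zone(3)[OF that True] uA_eq_uc_iff[OF dom_ge_1[OF d]] True by auto
    then show ?thesis using vS_uA[OF d] by simp
  next
    case False
    then show ?thesis using zone_split[OF OmegaD(1)[OF that]] velocity_zone(1,2)[OF that] by blast
  qed
  from this[OF assms(1)] this[OF assms(2)] show ?thesis using assms(3,4) by auto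
qed

text \<open>
  Velocity increases with \<open>u\<close> and with \<open>h\<close>, so a larger spacing must be compensated by a smaller
  \<open>h\<close>. For \<open>h1 \<le> h2\<close> the proof climbs from the first state to the second: it raises \<open>h\<close> at
  constant \<open>u1\<close>, then raises \<open>u\<close>. In the congested zone the vertical segment may leave \<open>Omega\<close>
  through the deceleration curve; the path then follows that curve up to the scanning curve of \<open>h2\<close>.
\<close>

lemma hysteresis_decreases:
  assumes o: "(u1, h1) \<in> Omega M" "(u2, h2) \<in> Omega M" and u: "u1 < u2" and v: "vS M u1 h1 = vS M u2 h2"
  shows "h2 < h1"
proof (rule ccontr)
  assume "\<not> h2 < h1"
  then have le: "h1 \<le> h2" by simp
  note d1 = OmegaD[OF o(1)] and d2 = OmegaD[OF o(2)]
  have le_case: "vS M u1 h1 \<le> vS M u1 b" if "h1 \<le> b" "\<And>k. h1 \<le> k \<Longrightarrow> k \<le> b \<Longrightarrow> (u1, k) \<in> Omega M" for b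
    using vS_strict_hysteresis[of h1 b u1] that by (cases "h1 = b") auto
  from same_zone[OF o _ v] u consider "h1 \<in> congested" "h2 \<in> congested" | "h1 \<in> free" "h2 \<in> free" by auto
  then show False
  proof cases
    case 1
    have sub: "{h1..h2} \<subseteq> congested" using interval_segment_subset[OF congested_branch(1)] 1 by blast
    have mono: "uA M a \<le> uA M b" "uD M a \<le> uD M b" if "h1 \<le> a" "a \<le> b" "b \<le> h2" for a b
      using subsetD[OF sub, of a] subsetD[OF sub, of b] that strict_mono_on_leD[OF congested_strict_mono(1), of a b]
        strict_mono_on_leD[OF congested_strict_mono(2), of a b] by auto
    have up: "u1 \<le> uA M k" if "h1 \<le> k" "k \<le> h2" for k using mono(1)[of h1 k] that d1 by auto
    show False
    proof (cases "uD M h2 \<le> u1")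
      case True
      have "(u1, k) \<in> Omega M" if "h1 \<le> k" "k \<le> h2" for k
        using mono(2)[of k h2] up[OF that] that True sub by (intro OmegaI) (auto simp: congested_def)
      from le_case[OF le this] vS_strict_spacing[OF this o(2)] show False using le u v by fastforce
    next
      case False
      let ?k = "hD M u1"
      have k: "?k \<in> dom_uD M" "uD M ?k = u1" using hD_inverse d1(4) by auto
      then have kc: "?k \<in> congested" using False 1 by (auto simp: congested_def)
      have "h1 \<le> ?k" "?k \<le> h2"
        using strict_mono_on_less[OF congested_strict_mono(2), of ?k h1]
          strict_mono_on_less[OF congested_strict_mono(2), of h2 ?k] k kc 1 False d1 by (auto simp: not_less)
      moreover have "(u1, l) \<in> Omega M" if "h1 \<le> l" "l \<le> ?k" for l
        using mono(2)[of l ?k] up[of l] that k \<open>?k \<le> h2\<close> subsetD[OF sub, of l] by (intro OmegaI) (auto simp: congested_def)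
      ultimately have "vS M u1 h1 \<le> vS M u1 ?k" using le_case by blast
      also have "\<dots> = vD M u1" using vS_uD[OF k(1)] k by simp
      also have "\<dots> < vD M (uD M h2)" using False d1 by (intro vD_strict) auto
      also have "\<dots> \<le> vS M u2 h2"
        using vS_uD[OF d2(1)] vS_strict_spacing[OF OmegaI[OF d2(1) order_refl uD_le_uA[OF d2(1)]] o(2)] d2
        by (cases "u2 = uD M h2") auto
      finally show False using v by simp
    qed
  next
    case 2
    have sub: "{h1..h2} \<subseteq> free" using interval_segment_subset[OF free_branch(1)] 2 by blast
    have anti: "uA M b \<le> uA M a" "uD M b \<le> uD M a" if "h1 \<le> a" "a \<le> b" "b \<le> h2" for a b
      using subsetD[OF sub, of a] subsetD[OF sub, of b] that strict_antimono_on_leD[OF free_strict_antimono(1), of a b]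
        strict_antimono_on_leD[OF free_strict_antimono(2), of a b] by auto
    have "(u1, k) \<in> Omega M" if "h1 \<le> k" "k \<le> h2" for k
      using anti(2)[of h1 k] anti(1)[of k h2] that sub d1 d2 u by (intro OmegaI) (auto simp: free_def)
    from le_case[OF le this] vS_strict_spacing[OF this o(2)] show False using le u v by fastforce
  qed
qed

text \<open>
  The range of \<open>h\<close> between two states of equal velocity lies in one zone, where \<open>uD\<close> and \<open>uA\<close> are
  continuous and both increase or both decrease. The last two claims hold in either case and say
  that, at a fixed spacing, the admissible values of \<open>h\<close> form an interval.
\<close>

lemma connecting_box:
  assumes o: "(u1, h1) \<in> Omega M" "(u2, h2) \<in> Omega M" and u: "u1 < u2" and v: "vS M u1 h1 = vS M u2 h2"
  shows "h2 < h1" "{h2..h1} \<subseteq> dom_uD M"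
    "continuous_on {h2..h1} (uD M)" "continuous_on {h2..h1} (uA M)"
    "\<And>a k b. h2 \<le> a \<Longrightarrow> a \<le> k \<Longrightarrow> k \<le> b \<Longrightarrow> b \<le> h1 \<Longrightarrow> uD M k \<le> max (uD M a) (uD M b)"
    "\<And>a k b. h2 \<le> a \<Longrightarrow> a \<le> k \<Longrightarrow> k \<le> b \<Longrightarrow> b \<le> h1 \<Longrightarrow> min (uA M a) (uA M b) \<le> uA M k"
proof -
  show less: "h2 < h1" by (rule hysteresis_decreases[OF assms])
  have "\<exists>Z. {h2..h1} \<subseteq> Z \<and> Z \<subseteq> dom_uD M \<and> continuous_on Z (uD M) \<and> continuous_on Z (uA M) \<and>
    (strict_mono_on Z (uD M) \<and> strict_mono_on Z (uA M) \<or> strict_antimono_on Z (uD M) \<and> strict_antimono_on Z (uA M))"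
  proof -
    consider "h1 \<in> congested" "h2 \<in> congested" | "h1 \<in> free" "h2 \<in> free"
      using same_zone[OF o _ v] u by auto
    then show ?thesis
    proof cases
      case h: 1
      have "continuous_on congested (uA M)"
        by (rule continuous_on_subset[OF uA_below_branch(1)]) (use congested_uA in auto)
      then show ?thesis
        using interval_segment_subset[OF congested_branch(1) h(2,1)] congested_branch(2) congested_strict_mono
        by (intro exI[of _ congested]) (auto simp: congested_def)
    next
      case h: 2
      have "continuous_on free (uA M)"
        by (rule continuous_on_subset[OF uA_above_branch(1)]) (use free_uA in auto)
      then show ?thesis
        using interval_segment_subset[OF free_branch(1) h(2,1)] free_branch(2) free_strict_antimono
        by (intro exI[of _ free]) (auto simp: free_def)
    qed
  qed
  then obtain Z where Z: "{h2..h1} \<subseteq> Z" "Z \<subseteq> dom_uD M" "continuous_on Z (uD M)" "continuous_on Z (uA M)"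
    and m: "strict_mono_on Z (uD M) \<and> strict_mono_on Z (uA M) \<or> strict_antimono_on Z (uD M) \<and> strict_antimono_on Z (uA M)"
    by blast
  show "{h2..h1} \<subseteq> dom_uD M" using Z by blast
  show "continuous_on {h2..h1} (uD M)" "continuous_on {h2..h1} (uA M)"
    using Z continuous_on_subset by blast+
  fix a k b assume *: "h2 \<le> a" "a \<le> k" "k \<le> b" "b \<le> h1"
  then have z: "a \<in> Z" "k \<in> Z" "b \<in> Z" using Z(1) by auto
  have "uD M a \<le> uD M k \<and> uD M k \<le> uD M b \<and> uA M a \<le> uA M k \<and> uA M k \<le> uA M b \<or>
        uD M b \<le> uD M k \<and> uD M k \<le> uD M a \<and> uA M b \<le> uA M k \<and> uA M k \<le> uA M a"
    using m
  proof
    assume "strict_mono_on Z (uD M) \<and> strict_mono_on Z (uA M)"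
    then show ?thesis using z *(2,3) strict_mono_on_leD by blast
  next
    assume "strict_antimono_on Z (uD M) \<and> strict_antimono_on Z (uA M)"
    then show ?thesis using z *(2,3) strict_antimono_on_leD by blast
  qed
  then show "uD M k \<le> max (uD M a) (uD M b)" "min (uA M a) (uA M b) \<le> uA M k" by auto
qed

section \<open>Level curves of the velocity\<close>

lemma vSu_cont: "continuous_on (Omega M) (\<lambda>(u, h). deriv (\<lambda>x. vS M x h) u)"
  and vSh_cont: "continuous_on (Omega M) (\<lambda>(u, h). deriv (vS M u) h)"
  using vS_smooth(2,3)[OF vS_smooth_around] .

lemma vS_cont: "continuous_on (Omega M) (\<lambda>(u, h). vS M u h)"
proof (rule continuous_at_imp_continuous_on, rule ballI)
  fix p assume "p \<in> Omega M"
  then show "isCont (\<lambda>(u, h). vS M u h) p"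
    using has_derivative_continuous[OF vS_smooth(1)[OF vS_smooth_around, of "fst p" "snd p"]] by simp
qed

lemma vS_slope_bound:
  assumes "h \<in> dom_uD M" "uD M h \<le> a" "b \<le> uA M h"
  shows "\<exists>c>0. \<forall>x\<in>{a..b}. c \<le> deriv (\<lambda>x. vS M x h) x"
proof (rule compact_positive_lower_bound)
  have o: "(x, h) \<in> Omega M" if "x \<in> {a..b}" for x using assms that by (intro OmegaI) auto
  have "continuous_on {a..b} (\<lambda>x. (\<lambda>(u, h). deriv (\<lambda>x. vS M x h) u) (x, h))"
    by (rule continuous_on_compose2[OF vSu_cont]) (auto intro!: continuous_intros o)
  then show "continuous_on {a..b} (\<lambda>x. deriv (\<lambda>x. vS M x h) x)" by simp
  show "0 < deriv (\<lambda>x. vS M x h) x" if "x \<in> {a..b}" for x by (rule vS_deriv_pos(1)[OF o[OF that]])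
qed simp

lemma vS_growth:
  assumes "h \<in> dom_uD M" "uD M h \<le> a" "a \<le> b" "b \<le> uA M h"
    and "\<And>x. a \<le> x \<Longrightarrow> x \<le> b \<Longrightarrow> c \<le> deriv (\<lambda>x. vS M x h) x"
  shows "vS M a h + c * (b - a) \<le> vS M b h"
proof (rule derivative_lower_bound_imp_growth[where f = "\<lambda>x. vS M x h" and f' = "\<lambda>x. deriv (\<lambda>x. vS M x h) x"])
  fix x assume "a \<le> x" "x \<le> b"
  then show "((\<lambda>x. vS M x h) has_real_derivative deriv (\<lambda>x. vS M x h) x) (at x)"
    using assms by (intro vS_smooth(4)[OF vS_smooth_around] OmegaI) auto
qed (use assms in auto)

text \<open>
  At constant \<open>h\<close> the velocity grows at least linearly in \<open>u\<close>, because its slopes on the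
  deceleration curve and on the scanning curve are bounded below on compact intervals. To the left
  of a state it therefore falls short of the velocity there by a multiple of the distance. This is
  the room in which the velocity of a profile may deviate from its limit.
\<close>

lemma velocity_growth_left:
  assumes o: "(b, h) \<in> Omega M" and a: "1 \<le> a"
  shows "\<exists>c>0. \<forall>u\<in>{a..b}. velocity M u h \<le> vS M b h - c * (b - u)"
proof -
  note d = OmegaD[OF o]
  obtain c1 where c1: "c1 > 0" "\<forall>x\<in>{a..b}. c1 \<le> deriv (vD M) x"
    using compact_positive_lower_bound[OF compact_Icc continuous_on_subset[OF vD_smooth(2)], of a b]
      standing a by (fastforce simp: standing_assumption_def)
  obtain c2 where c2: "c2 > 0" "\<forall>x\<in>{uD M h..b}. c2 \<le> deriv (\<lambda>x. vS M x h) x"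
    using vS_slope_bound[OF d(1) order_refl d(3)] by blast
  define c where "c = min c1 c2"
  have c: "c > 0" "c \<le> c1" "c \<le> c2" using c1 c2 by (auto simp: c_def)
  have "velocity M u h \<le> vS M b h - c * (b - u)" if u: "u \<in> {a..b}" for u
  proof (cases "uD M h \<le> u")
    case True
    then have "(u, h) \<in> Omega M" using u d by (intro OmegaI) auto
    moreover have "vS M u h + c * (b - u) \<le> vS M b h"
      using True u d c2 c(3) by (intro vS_growth) (auto intro: order_trans[OF c(3)])
    ultimately show ?thesis by (simp add: velocity_Omega)
  next
    case False
    have "vD M u + c * (uD M h - u) \<le> vD M (uD M h)"
      using False u a d by (intro derivative_lower_bound_imp_growth[where f' = "deriv (vD M)"] vD_smooth(1) order_trans[OF c(2)])
        (use c1(2) in auto)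
    moreover have "vS M (uD M h) h + c * (b - uD M h) \<le> vS M b h"
      using d c2 c(3) by (intro vS_growth) (auto intro: order_trans[OF c(3)])
    ultimately show ?thesis using False vS_uD[OF d(1)] by (simp add: velocity_def algebra_simps)
  qed
  then show ?thesis using c(1) by blast
qed

lemma velocity_growth_right:
  assumes o: "(a, h) \<in> Omega M"
  shows "\<exists>c>0. \<forall>u\<in>{a..b}. vS M a h + c * (u - a) \<le> velocity M u h"
proof -
  note d = OmegaD[OF o]
  have u0: "u0A M \<le> uA M h" by (rule uA_ge[OF d(1)])
  obtain c1 where c1: "c1 > 0" "\<forall>x\<in>{uA M h..b}. c1 \<le> deriv (vA M) x"
    using compact_positive_lower_bound[OF compact_Icc continuous_on_subset[OF vA_smooth(2)], of "uA M h" b]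
      standing u0 by (fastforce simp: standing_assumption_def)
  obtain c2 where c2: "c2 > 0" "\<forall>x\<in>{a..uA M h}. c2 \<le> deriv (\<lambda>x. vS M x h) x"
    using vS_slope_bound[OF d(1) d(2) order_refl] by blast
  define c where "c = min c1 c2"
  have c: "c > 0" "c \<le> c1" "c \<le> c2" using c1 c2 by (auto simp: c_def)
  have "vS M a h + c * (u - a) \<le> velocity M u h" if u: "u \<in> {a..b}" for u
  proof (cases "u \<le> uA M h")
    case True
    then have "(u, h) \<in> Omega M" using u d by (intro OmegaI) auto
    moreover have "vS M a h + c * (u - a) \<le> vS M u h"
      using True u d c2 c(3) by (intro vS_growth) (auto intro: order_trans[OF c(3)])
    ultimately show ?thesis by (simp add: velocity_Omega)
  next
    case False
    have "vA M (uA M h) + c * (u - uA M h) \<le> vA M u"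
      using False u u0 by (intro derivative_lower_bound_imp_growth[where f' = "deriv (vA M)"] vA_smooth(1) order_trans[OF c(2)])
        (use c1(2) in auto)
    moreover have "vS M a h + c * (uA M h - a) \<le> vS M (uA M h) h"
      using d c2 c(3) by (intro vS_growth) (auto intro: order_trans[OF c(3)])
    ultimately show ?thesis using False uD_le_uA[OF d(1)] vS_uA[OF d(1)]
      by (simp add: velocity_def algebra_simps)
  qed
  then show ?thesis using c(1) by blast
qed

text \<open>
  Clamping the spacing to the segment between \<open>uD h\<close> and \<open>uA h\<close> removes the case distinction: each
  term depends continuously on \<open>h\<close>, and the two differences vanish inside \<open>Omega\<close>.
\<close>

lemma velocity_decomposition:
  assumes h: "h \<in> dom_uD M"
  shows "velocity M u h = vS M (max (uD M h) (min (uA M h) u)) h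
    + (vD M (min u (uD M h)) - vD M (uD M h)) + (vA M (max u (uA M h)) - vA M (uA M h))"
proof -
  have le: "uD M h \<le> uA M h" by (rule uD_le_uA[OF h])
  consider "u \<le> uD M h" | "uD M h < u" "u < uA M h" | "uD M h < u" "uA M h \<le> u" by linarith
  then show ?thesis
  proof cases
    case 1
    then have "min (uA M h) u = u" "max (uD M h) u = uD M h" "min u (uD M h) = u" "max u (uA M h) = uA M h"
      using le by auto
    then show ?thesis using 1 vS_uD[OF h] by (simp add: velocity_def)
  next
    case 2
    then show ?thesis by (simp add: velocity_def)
  next
    case 3
    then have "min (uA M h) u = uA M h" "max (uD M h) (uA M h) = uA M h" "min u (uD M h) = uD M h"
        "max u (uA M h) = u"
      using le by auto
    then show ?thesis using 3 vS_uA[OF h] by (simp add: velocity_def)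
  qed
qed

lemma velocity_cont_hysteresis:
  assumes J: "J \<subseteq> dom_uD M" and c: "continuous_on J (uD M)" "continuous_on J (uA M)" and u: "1 \<le> u"
  shows "continuous_on J (velocity M u)"
proof -
  have "continuous_on J (\<lambda>h. (\<lambda>(u, h). vS M u h) (max (uD M h) (min (uA M h) u), h))"
    by (rule continuous_on_compose2[OF vS_cont])
      (use J uD_le_uA in \<open>auto intro!: continuous_intros c OmegaI\<close>)
  moreover have "continuous_on J (\<lambda>h. vD M (min u (uD M h)))"
    by (rule continuous_on_compose2[OF vD_cont]) (use J uD_ge_1 u in \<open>auto intro!: continuous_intros c\<close>)
  moreover have "continuous_on J (\<lambda>h. vD M (uD M h))"
    by (rule continuous_on_compose2[OF vD_cont c(1)]) (use J uD_ge_1 in auto)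
  moreover have "continuous_on J (\<lambda>h. vA M (max u (uA M h)))"
    by (rule continuous_on_compose2[OF vA_cont])
      (use J uA_ge in \<open>auto intro!: continuous_intros c simp: le_max_iff_disj\<close>)
  moreover have "continuous_on J (\<lambda>h. vA M (uA M h))"
    by (rule continuous_on_compose2[OF vA_cont c(2)]) (use J uA_ge in auto)
  ultimately have "continuous_on J (\<lambda>h. vS M (max (uD M h) (min (uA M h) u)) h
    + (vD M (min u (uD M h)) - vD M (uD M h)) + (vA M (max u (uA M h)) - vA M (uA M h)))"
    by (auto intro!: continuous_intros)
  then show ?thesis
    by (rule continuous_on_eq) (use J velocity_decomposition in auto)
qed

text \<open>
  For each spacing \<open>x\<close> the equation \<open>v(x, h) = w x\<close> has a root \<open>h\<close> by the intermediate value theorem.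
  The root lies in \<open>Omega\<close>: outside, the velocity at \<open>(x, h)\<close> would be read off the deceleration or
  the acceleration curve, hence coincide with the one for \<open>hl\<close> or \<open>hr\<close>, which the strict bounds
  \<open>low\<close> and \<open>high\<close> exclude. It is unique because \<open>vS\<close> increases in \<open>h\<close> along the admissible
  interval. So the roots form a closed graph in a compact box, which makes \<open>g\<close> continuous; the
  derivative of \<open>vS\<close> in \<open>h\<close> is bounded away from 0 on the compact part \<open>R\<close> of \<open>Omega\<close>, which
  makes \<open>g\<close> differentiable with bounded derivative.
\<close>

lemma level_curve:
  assumes o: "(ul, hr) \<in> Omega M" "(ur, hl) \<in> Omega M" and u: "ul < ur" and v: "vS M ul hr = vS M ur hl"
    and w: "\<And>x. x \<in> {ul..ur} \<Longrightarrow> (w has_real_derivative w' x) (at x)" "continuous_on {ul..ur} w'"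
    and w_ends: "w ul = vS M ul hr" "w ur = vS M ur hl"
    and low: "\<And>x. ul \<le> x \<Longrightarrow> x < ur \<Longrightarrow> velocity M x hl < w x"
    and high: "\<And>x. ul < x \<Longrightarrow> x \<le> ur \<Longrightarrow> w x < velocity M x hr"
  shows "\<exists>g B. continuous_on {ul..ur} g \<and> g ul = hr \<and> g ur = hl \<and>
    (\<forall>x\<in>{ul..ur}. (x, g x) \<in> Omega M \<and> vS M x (g x) = w x) \<and>
    (\<forall>x\<in>{ul<..<ur}. \<exists>d. \<bar>d\<bar> \<le> B \<and> (g has_real_derivative d) (at x))"
proof -
  note box = connecting_box[OF o u v]
  note d1 = OmegaD[OF o(1)] and d2 = OmegaD[OF o(2)]
  let ?I = "{ul..ur}" and ?J = "{hl..hr}"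
  define R where "R = {p \<in> ?I \<times> ?J. uD M (snd p) \<le> fst p \<and> fst p \<le> uA M (snd p)}"
  have R: "(x, h) \<in> R \<longleftrightarrow> x \<in> ?I \<and> h \<in> ?J \<and> (x, h) \<in> Omega M" for x h
    using box(2) d1(4) by (auto simp: R_def Omega_def)
  have uniq: "h = h'" if "(x, h) \<in> R" "(x, h') \<in> R" "vS M x h = vS M x h'" for x h h'
  proof -
    have "\<not> h < h'" if *: "(x, h) \<in> R" "(x, h') \<in> R" "vS M x h = vS M x h'" for h h'
    proof
      assume "h < h'"
      moreover have "(x, k) \<in> Omega M" if "h \<le> k" "k \<le> h'" for k
        using box(5)[of h k h'] box(6)[of h k h'] that * subsetD[OF box(2), of k]
        by (intro OmegaI) (auto simp: R_def)
      ultimately show False using vS_strict_hysteresis[of h h' x] *(3) by auto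
    qed
    from this[OF that] this[OF that(2,1)] that(3) show ?thesis by force
  qed
  have ex: "\<exists>h. (x, h) \<in> R \<and> vS M x h = w x" if x: "x \<in> ?I" for x
  proof -
    have "velocity M x hl \<le> w x"
      using low[of x] x velocity_Omega[OF o(2)] w_ends by (cases "x = ur") (auto intro: less_imp_le)
    moreover have "w x \<le> velocity M x hr"
      using high[of x] x velocity_Omega[OF o(1)] w_ends by (cases "x = ul") (auto intro: less_imp_le)
    moreover have "continuous_on ?J (velocity M x)"
      by (rule velocity_cont_hysteresis[OF box(2-4)]) (use x d1 in auto)
    ultimately obtain h where h: "hl \<le> h" "h \<le> hr" "velocity M x h = w x"
      using IVT'[of "velocity M x" hl "w x" hr] box(1) by auto
    have dom: "h \<in> dom_uD M" using box(2) h by auto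
    have "uD M h \<le> x"
    proof (rule ccontr)
      assume "\<not> uD M h \<le> x"
      moreover from this have "x < uD M hl" using box(5)[of hl h hr] h d1(2) x by auto
      ultimately have "velocity M x hl = velocity M x h" by (simp add: velocity_def)
      then show False using low[of x] h(3) x d2(2) \<open>x < uD M hl\<close> by auto
    qed
    moreover have "x \<le> uA M h"
    proof (rule ccontr)
      assume *: "\<not> x \<le> uA M h"
      then have **: "uA M hr < x" using box(6)[of hl h hr] h d2(3) x by auto
      have "velocity M x hr = velocity M x h"
        using * ** uD_le_uA[OF dom] uD_le_uA[OF d1(1)] by (simp add: velocity_def)
      then show False using high[of x] h(3) x d1(3) ** by auto
    qed
    ultimately have o': "(x, h) \<in> Omega M" using dom by (intro OmegaI)
    then show ?thesis using h velocity_Omega[OF o'] x by (auto simp: R)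
  qed
  then obtain g where g: "\<And>x. x \<in> ?I \<Longrightarrow> (x, g x) \<in> R \<and> vS M x (g x) = w x" by metis
  have g_eq: "g x = h" if "(x, h) \<in> R" "vS M x h = w x" for x h
    using uniq[of x "g x" h] g[of x] that by (auto simp: R)
  have contJ: "continuous_on (?I \<times> ?J) (\<lambda>p. f (snd p))" if "continuous_on ?J f" for f :: "real \<Rightarrow> real"
    by (rule continuous_on_compose2[OF that]) (auto intro: continuous_intros)
  have "closed {p \<in> ?I \<times> ?J. uD M (snd p) \<le> fst p}" "closed {p \<in> ?I \<times> ?J. fst p \<le> uA M (snd p)}"
    by (intro continuous_on_closed_Collect_le contJ box continuous_intros closed_Times closed_atLeastAtMost)+
  moreover have "R = {p \<in> ?I \<times> ?J. uD M (snd p) \<le> fst p} \<inter> {p \<in> ?I \<times> ?J. fst p \<le> uA M (snd p)}"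
    by (auto simp: R_def)
  ultimately have clR: "closed R" by auto
  moreover have "R \<subseteq> ?I \<times> ?J" by (auto simp: R_def)
  ultimately have compR: "compact R"
    using compact_Int_closed[OF compact_Times[OF compact_Icc compact_Icc], of R ul ur hl hr]
    by (simp add: Int_absorb1)
  have subR: "R \<subseteq> Omega M" using R by auto
  have contw: "continuous_on ?I w"
    by (rule continuous_at_imp_continuous_on) (use w(1) DERIV_isCont in blast)
  have "continuous_on R (\<lambda>p. (\<lambda>(u, h). vS M u h) p - w (fst p))"
    by (intro continuous_intros continuous_on_subset[OF vS_cont subR] continuous_on_compose2[OF contw])
      (auto simp: R_def)
  then have "closed {p \<in> R. (\<lambda>(u, h). vS M u h) p - w (fst p) = 0}"
    by (rule continuous_closed_preimage_constant[OF _ clR])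
  moreover have "{p \<in> R. (\<lambda>(u, h). vS M u h) p - w (fst p) = 0} = (\<lambda>x. (x, g x)) ` ?I"
  proof (intro equalityI subsetI)
    fix p assume "p \<in> {p \<in> R. (\<lambda>(u, h). vS M u h) p - w (fst p) = 0}"
    then show "p \<in> (\<lambda>x. (x, g x)) ` ?I" using g_eq[of "fst p" "snd p"] by (cases p) (auto simp: R)
  next
    fix p assume "p \<in> (\<lambda>x. (x, g x)) ` ?I"
    then show "p \<in> {p \<in> R. (\<lambda>(u, h). vS M u h) p - w (fst p) = 0}" using g by auto
  qed
  ultimately have "closed ((\<lambda>x. (x, g x)) ` ?I)" by simp
  then have contg: "continuous_on ?I g"
    using g by (intro continuous_from_closed_graph[OF compact_Icc[of hl hr]]) (auto simp: R)
  have "\<exists>c>0. \<forall>p\<in>R. c \<le> (\<lambda>(u, h). deriv (vS M u) h) p"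
    by (rule compact_positive_lower_bound[OF compR continuous_on_subset[OF vSh_cont subR]])
      (use vS_deriv_pos(2) subR in auto)
  then obtain m where m_pos: "m > 0" and m_le: "\<And>p. p \<in> R \<Longrightarrow> m \<le> (\<lambda>(u, h). deriv (vS M u) h) p" by blast
  have m: "m > 0" "m \<le> deriv (vS M u) h" if "(u, h) \<in> R" for u h using m_pos m_le[OF that] by auto
  have "bounded ((\<lambda>(u, h). deriv (\<lambda>x. vS M x h) u) ` R)" "bounded (w' ` ?I)"
    by (intro compact_imp_bounded compact_continuous_image compR compact_Icc w(2)
        continuous_on_subset[OF vSu_cont subR])+
  then obtain B1 B2 where B1: "\<And>u h. (u, h) \<in> R \<Longrightarrow> \<bar>deriv (\<lambda>x. vS M x h) u\<bar> \<le> B1"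
    and B2: "\<And>x. x \<in> ?I \<Longrightarrow> \<bar>w' x\<bar> \<le> B2"
    unfolding bounded_iff real_norm_def ball_simps by (auto simp: Ball_def)
  have "\<exists>d. \<bar>d\<bar> \<le> (B1 + B2) / m \<and> (g has_real_derivative d) (at x)" if x: "x \<in> {ul<..<ur}" for x
  proof -
    let ?p = "deriv (\<lambda>y. vS M y (g x)) x" and ?q = "deriv (vS M x) (g x)"
    have xI: "x \<in> ?I" using x by auto
    have gx: "(x, g x) \<in> R" "(x, g x) \<in> Omega M" using g[OF xI] subR by auto
    have "isCont g x" using continuous_on_interior[OF contg] x by (simp add: interior_atLeastAtMost_real)
    moreover have "\<forall>\<^sub>F y in at x. (\<lambda>(u, h). vS M u h) (y, g y) = w y"
    proof -
      have "\<forall>\<^sub>F y in at x. y \<in> {ul<..<ur}" using x by (intro eventually_at_in_open') auto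
      then show ?thesis by eventually_elim (use g in auto)
    qed
    moreover have "?q \<noteq> 0" using vS_deriv_pos(2)[OF gx(2)] by simp
    ultimately have "(g has_real_derivative (w' x - ?p) / ?q) (at x)"
      using g[OF xI] by (intro implicit_derivative[where F = "\<lambda>(u, h). vS M u h" and w = w]
          vS_smooth(1)[OF vS_smooth_around gx(2)] w(1)[OF xI]) auto
    moreover have "\<bar>(w' x - ?p) / ?q\<bar> \<le> (B1 + B2) / m"
      unfolding abs_divide using m[OF gx(1)] B1[OF gx(1)] B2[OF xI]
      by (intro frac_le) auto
    ultimately show ?thesis by blast
  qed
  moreover have "g ul = hr" "g ur = hl"
    using box(1) u o w_ends by (auto intro!: g_eq simp: R)
  ultimately show ?thesis using contg g subR by (intro exI[of _ g] exI[of _ "(B1 + B2) / m"]) auto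
qed

section \<open>Stationary profiles\<close>

text \<open>
  The logistic curve \<open>u\<close> solves \<open>u' = \<kappa> (u - um) (up - u) / (up - um)\<close>, and \<open>g\<close> has been chosen
  such that this right-hand side is the difference of velocities required of a profile with \<open>s = 0\<close>.
  Since \<open>u'\<close> vanishes at both ends and \<open>g\<close> has bounded derivative, \<open>h' = g'(u) u'\<close> vanishes there
  too.
\<close>

lemma profile_of_level_curve:
  fixes g :: "real \<Rightarrow> real"
  assumes ne: "um \<noteq> up" and \<kappa>: "0 < \<kappa>" and v: "velocity M um hm = velocity M up hp"
    and g: "continuous_on {min um up..max um up} g" "g um = hm" "g up = hp"
    and level: "\<And>x. x \<in> {min um up..max um up} \<Longrightarrow> (x, g x) \<in> Omega M \<and>
      vS M x (g x) = velocity M um hm - \<kappa> * ((x - um) * (up - x) / (up - um))"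
    and dg: "\<And>x. x \<in> {min um up<..<max um up} \<Longrightarrow> \<exists>d. \<bar>d\<bar> \<le> B \<and> (g has_real_derivative d) (at x)"
  defines "u \<equiv> \<lambda>\<xi>. um + (up - um) / (1 + exp (- \<kappa> * \<xi>))"
  shows "viscous_profile M (um, hm) (up, hp) u (\<lambda>\<xi>. g (u \<xi>))"
proof -
  let ?I = "{min um up..max um up}"
  define u' where "u' = (\<lambda>\<xi>. \<kappa> * ((u \<xi> - um) * (up - u \<xi>) / (up - um)))"
  have inside: "u \<xi> \<in> {min um up<..<max um up}" for \<xi>
  proof -
    have "0 < 1 / (1 + exp (- \<kappa> * \<xi>))" "1 / (1 + exp (- \<kappa> * \<xi>)) < 1" by (auto simp: add_pos_pos)
    moreover define t where "t = 1 / (1 + exp (- \<kappa> * \<xi>))"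
    moreover have "u \<xi> = um + (up - um) * t" by (simp add: u_def t_def)
    moreover have "min um up < um + (up - um) * t \<and> um + (up - um) * t < max um up" if "0 < t" "t < 1"
    proof (cases "um < up")
      case True
      then have "0 < (up - um) * t" "(up - um) * t < up - um"
        using that mult_strict_left_mono[of t 1 "up - um"] by simp_all
      then have "um < um + (up - um) * t" "um + (up - um) * t < up" by linarith+
      then show ?thesis by (simp only: min_less_iff_disj less_max_iff_disj simp_thms)
    next
      case False
      then have "(up - um) * t < 0" "up - um < (up - um) * t"
        using that ne mult_strict_left_mono_neg[of t 1 "up - um"] by (simp_all add: mult_neg_pos)
      then have "up < um + (up - um) * t" "um + (up - um) * t < um" by linarith+
      then show ?thesis by (simp only: min_less_iff_disj less_max_iff_disj simp_thms)
    qed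
    ultimately show ?thesis by auto
  qed
  have inI: "u \<xi> \<in> ?I" for \<xi>
    by (rule subsetD[OF _ inside]) (auto simp: less_imp_le)
  have du: "(u has_real_derivative u' \<xi>) (at \<xi>)" for \<xi>
  proof -
    have pos: "1 + exp (- \<kappa> * \<xi>) \<noteq> 0" by (metis add_pos_pos exp_gt_zero less_irrefl zero_less_one)
    have "(u has_real_derivative (up - um) * (\<kappa> * exp (- \<kappa> * \<xi>)) / (1 + exp (- \<kappa> * \<xi>))\<^sup>2) (at \<xi>)"
      unfolding u_def using pos by (auto intro!: derivative_eq_intros simp: power2_eq_square)
    moreover have "u' \<xi> = (up - um) * (\<kappa> * exp (- \<kappa> * \<xi>)) / (1 + exp (- \<kappa> * \<xi>))\<^sup>2"
    proof -
      define E where "E = exp (- \<kappa> * \<xi>)"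
      have "up - um - (up - um) / (1 + E) = (up - um) * (E / (1 + E))"
        using pos unfolding E_def[symmetric] by (simp add: field_simps)
      then have "up - u \<xi> = (up - um) * (E / (1 + E))" unfolding u_def E_def[symmetric] by simp
      moreover have "u \<xi> - um = (up - um) * (1 / (1 + E))" unfolding u_def E_def[symmetric] by simp
      ultimately show ?thesis
        unfolding u'_def E_def[symmetric] using ne by (simp add: power2_eq_square)
    qed
    ultimately show ?thesis by simp
  qed
  have top: "(u \<longlongrightarrow> up) at_top" and bot: "(u \<longlongrightarrow> um) at_bot"
  proof -
    have lims: "((\<lambda>\<xi>. 1 / (1 + exp (- \<kappa> * \<xi>))) \<longlongrightarrow> 1) at_top" "((\<lambda>\<xi>. 1 / (1 + exp (- \<kappa> * \<xi>))) \<longlongrightarrow> 0) at_bot"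
      using \<kappa> by real_asymp+
    have "((\<lambda>\<xi>. um + (up - um) * (1 / (1 + exp (- \<kappa> * \<xi>)))) \<longlongrightarrow> um + (up - um) * 1) at_top"
      "((\<lambda>\<xi>. um + (up - um) * (1 / (1 + exp (- \<kappa> * \<xi>)))) \<longlongrightarrow> um + (up - um) * 0) at_bot"
      by (rule tendsto_add[OF tendsto_const tendsto_mult[OF tendsto_const lims(1)]],
          rule tendsto_add[OF tendsto_const tendsto_mult[OF tendsto_const lims(2)]])
    then show "(u \<longlongrightarrow> up) at_top" "(u \<longlongrightarrow> um) at_bot" by (simp_all add: u_def)
  qed
  have u'_lim: "(u' \<longlongrightarrow> 0) F" if "(u \<longlongrightarrow> um) F \<or> (u \<longlongrightarrow> up) F" for F
  proof -
    have "(u' \<longlongrightarrow> \<kappa> * ((l - um) * (up - l) / (up - um))) F" if "(u \<longlongrightarrow> l) F" for l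
      unfolding u'_def using that ne by (intro tendsto_intros) auto
    from this[of um] this[of up] that show ?thesis by auto
  qed
  have dh: "\<exists>d. \<bar>d\<bar> \<le> B * \<bar>u' \<xi>\<bar> \<and> ((\<lambda>\<xi>. g (u \<xi>)) has_real_derivative d) (at \<xi>)" for \<xi>
  proof -
    obtain d where d: "\<bar>d\<bar> \<le> B" "(g has_real_derivative d) (at (u \<xi>))" using dg[OF inside] by blast
    then have "((\<lambda>\<xi>. g (u \<xi>)) has_real_derivative d * u' \<xi>) (at \<xi>)" using DERIV_chain2[OF d(2) du] by simp
    moreover have "\<bar>d * u' \<xi>\<bar> \<le> B * \<bar>u' \<xi>\<bar>" unfolding abs_mult using d(1) by (intro mult_right_mono) auto
    ultimately show ?thesis by blast
  qed
  then have deriv_h: "\<bar>deriv (\<lambda>\<xi>. g (u \<xi>)) \<xi>\<bar> \<le> B * \<bar>u' \<xi>\<bar>" for \<xi> by (metis DERIV_imp_deriv)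
  have h_lim: "(deriv (\<lambda>\<xi>. g (u \<xi>)) \<longlongrightarrow> 0) F" if "(u \<longlongrightarrow> um) F \<or> (u \<longlongrightarrow> up) F" for F
  proof (rule Lim_null_comparison)
    show "((\<lambda>\<xi>. B * \<bar>u' \<xi>\<bar>) \<longlongrightarrow> 0) F"
      using tendsto_mult[OF tendsto_const[of B] tendsto_rabs_zero[OF u'_lim[OF that]]] by simp
  qed (use deriv_h in auto)
  have g_lim: "((\<lambda>\<xi>. g (u \<xi>)) \<longlongrightarrow> g l) F" if "(u \<longlongrightarrow> l) F" "l \<in> ?I" for F l
    by (rule continuous_on_tendsto_compose[OF g(1) that]) (simp add: inI del: atLeastAtMost_iff)
  have s: "shock_speed M (um, hm) (up, hp) = 0" using v by (simp add: shock_speed_def)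
  have deriv_u: "deriv u = u'" using DERIV_imp_deriv[OF du] by (simp add: fun_eq_iff)
  have vel: "velocity M (u \<xi>) (g (u \<xi>)) = velocity M um hm - u' \<xi>" for \<xi>
    using level[OF inI] velocity_Omega by (simp add: u'_def)
  have "(u has_real_derivative - 0 * (u \<xi> - um) - (velocity M (u \<xi>) (g (u \<xi>)) - velocity M um hm)) (at \<xi>)" for \<xi>
    using du[of \<xi>] by (simp add: vel)
  moreover have "1 \<le> u \<xi> \<and> g (u \<xi>) \<in> dom_uD M" for \<xi>
    using level[OF inI] OmegaD by blast
  moreover have "continuous_on UNIV (\<lambda>\<xi>. g (u \<xi>))"
    by (rule continuous_at_imp_continuous_on) (use dh DERIV_isCont in blast)
  moreover have "(\<lambda>\<xi>. g (u \<xi>)) differentiable (at \<xi>)" for \<xi>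
    using dh[of \<xi>] real_differentiable_def by blast
  ultimately show ?thesis
    unfolding viscous_profile_def prod.case s Let_def
    using top bot g_lim[OF top] g_lim[OF bot] g(2,3) u'_lim[of at_top] u'_lim[of at_bot]
      h_lim[of at_top] h_lim[of at_bot]
    by (auto simp: deriv_u intro: exI[of _ "{}"])
qed

text \<open>
  The deviation of the velocity from its limit is at most \<open>\<kappa>\<close> times the distance of the spacing to
  the nearer of the two states. For \<open>\<kappa>\<close> below the growth rates of the velocity at \<open>hl\<close> and \<open>hr\<close> it
  thus fits between \<open>v(x, hl)\<close> and \<open>v(x, hr)\<close>. The bound does not depend on whether the spacing
  increases or decreases along the profile.
\<close>

lemma stationary_profiles:
  assumes o: "(um, hm) \<in> Omega M" "(up, hp) \<in> Omega M" and ne: "um \<noteq> up"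
    and v: "velocity M um hm = velocity M up hp"
  shows "\<exists>c>0. \<forall>\<kappa>. 0 < \<kappa> \<and> \<kappa> < c \<longrightarrow> (\<exists>h. viscous_profile M (um, hm) (up, hp)
    (\<lambda>\<xi>. um + (up - um) / (1 + exp (- \<kappa> * \<xi>))) h)"
proof -
  \<comment> \<open>The state with the larger spacing \<open>ur\<close> is the one with the smaller \<open>h\<close>, hence named \<open>hl\<close>.\<close>
  define ul ur hr hl where "ul = min um up" and "ur = max um up"
    and "hr = (if um < up then hm else hp)" and "hl = (if um < up then hp else hm)"
  have lr: "(ul, hr) \<in> Omega M" "(ur, hl) \<in> Omega M" "ul < ur"
    using o ne by (auto simp: ul_def ur_def hr_def hl_def min_def max_def)
  define v0 where "v0 = velocity M um hm"
  have v0: "vS M ul hr = v0" "vS M ur hl = v0"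
    using o v velocity_Omega ne
    by (auto simp: v0_def ul_def ur_def hr_def hl_def min_def max_def)
  obtain c1 where c1: "c1 > 0" "\<And>x. x \<in> {ul..ur} \<Longrightarrow> velocity M x hl \<le> v0 - c1 * (ur - x)"
    using velocity_growth_left[OF lr(2) OmegaD(4)[OF lr(1)]] v0 by auto
  obtain c2 where c2: "c2 > 0" "\<And>x. x \<in> {ul..ur} \<Longrightarrow> v0 + c2 * (x - ul) \<le> velocity M x hr"
    using velocity_growth_right[OF lr(1), of ur] v0 by auto
  have "\<exists>h. viscous_profile M (um, hm) (up, hp) (\<lambda>\<xi>. um + (up - um) / (1 + exp (- \<kappa> * \<xi>))) h"
    if \<kappa>: "0 < \<kappa>" "\<kappa> < c1" "\<kappa> < c2" for \<kappa>
  proof -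
    define w where "w = (\<lambda>x. v0 - \<kappa> * ((x - um) * (up - x) / (up - um)))"
    have small: "\<bar>(x - um) * (up - x) / (up - um)\<bar> \<le> min (x - ul) (ur - x)" if "x \<in> {ul..ur}" for x
    proof -
      have "\<bar>(x - um) * (up - x) / (up - um)\<bar> = (x - ul) * (ur - x) / (ur - ul)"
      proof -
        have nn: "0 \<le> (x - ul) * (ur - x) / (ur - ul)" using that lr(3) by simp
        have "(x - um) * (up - x) / (up - um) = (x - ul) * (ur - x) / (ur - ul) \<or>
              (x - um) * (up - x) / (up - um) = - ((x - ul) * (ur - x) / (ur - ul))"
        proof (cases "um < up")
          case True
          then show ?thesis by (simp add: ul_def ur_def)
        next
          case False
          then have "ul = up" "ur = um" by (auto simp: ul_def ur_def)
          moreover have "(x - um) * (up - x) = (x - up) * (um - x)" by (simp add: algebra_simps)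
          moreover have "up - um = - (um - up)" by simp
          ultimately show ?thesis by (simp only: divide_minus_right) simp
        qed
        then show ?thesis using nn by (metis abs_minus_cancel abs_of_nonneg)
      qed
      moreover have "(x - ul) * (ur - x) \<le> (x - ul) * (ur - ul)" "(x - ul) * (ur - x) \<le> (ur - ul) * (ur - x)"
        using that by (auto intro!: mult_left_mono mult_right_mono)
      ultimately show ?thesis using lr(3) by (simp add: pos_divide_le_eq mult.commute)
    qed
    have bound: "\<bar>w x - v0\<bar> \<le> \<kappa> * min (x - ul) (ur - x)" if "x \<in> {ul..ur}" for x
      using mult_left_mono[OF small[OF that], of \<kappa>] \<kappa>(1) by (simp add: w_def abs_mult)
    have "\<exists>g B. continuous_on {ul..ur} g \<and> g ul = hr \<and> g ur = hl \<and>
      (\<forall>x\<in>{ul..ur}. (x, g x) \<in> Omega M \<and> vS M x (g x) = w x) \<and>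
      (\<forall>x\<in>{ul<..<ur}. \<exists>d. \<bar>d\<bar> \<le> B \<and> (g has_real_derivative d) (at x))"
    proof (rule level_curve[OF lr])
      show "vS M ul hr = vS M ur hl" "w ul = vS M ul hr" "w ur = vS M ur hl"
        using v0 by (auto simp: w_def ul_def ur_def min_def max_def)
      show "(w has_real_derivative - \<kappa> * ((up - x) - (x - um)) / (up - um)) (at x)" for x
      proof -
        have "((\<lambda>x. (x - um) * (up - x)) has_real_derivative (up - x) - (x - um)) (at x)"
          by (auto intro!: derivative_eq_intros)
        from DERIV_diff[OF DERIV_const[of v0] DERIV_cmult[OF DERIV_cdivide[OF this, of "up - um"], of \<kappa>]]
        show ?thesis unfolding w_def by simp
      qed
      show "continuous_on {ul..ur} (\<lambda>x. - \<kappa> * ((up - x) - (x - um)) / (up - um))"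
        using ne by (intro continuous_intros) auto
      show "velocity M x hl < w x" if x: "ul \<le> x" "x < ur" for x
      proof -
        have "\<kappa> * min (x - ul) (ur - x) \<le> \<kappa> * (ur - x)" using \<kappa>(1) by (intro mult_left_mono) auto
        also have "\<dots> < c1 * (ur - x)" using \<kappa>(2) x by simp
        finally show ?thesis using bound[of x] c1(2)[of x] x by auto
      qed
      show "w x < velocity M x hr" if x: "ul < x" "x \<le> ur" for x
      proof -
        have "\<kappa> * min (x - ul) (ur - x) \<le> \<kappa> * (x - ul)" using \<kappa>(1) by (intro mult_left_mono) auto
        also have "\<dots> < c2 * (x - ul)" using \<kappa>(3) x by simp
        finally show ?thesis using bound[of x] c2(2)[of x] x by auto
      qed
    qed
    then obtain g B where g: "continuous_on {ul..ur} g" "g ul = hr" "g ur = hl"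
      "\<And>x. x \<in> {ul..ur} \<Longrightarrow> (x, g x) \<in> Omega M \<and> vS M x (g x) = w x"
      "\<And>x. x \<in> {ul<..<ur} \<Longrightarrow> \<exists>d. \<bar>d\<bar> \<le> B \<and> (g has_real_derivative d) (at x)" by blast
    have "g um = hm" "g up = hp"
      using g(2,3) ne by (auto simp: ul_def ur_def hr_def hl_def min_def max_def split: if_splits)
    from profile_of_level_curve[OF ne \<kappa>(1) v g(1)[unfolded ul_def ur_def] this
        g(4)[unfolded ul_def ur_def w_def v0_def] g(5)[unfolded ul_def ur_def]]
    show ?thesis by blast
  qed
  then show ?thesis using c1(1) c2(1) by (intro exI[of _ "min c1 c2"]) auto
qed

end

theorem theorem4p4:
  fixes M :: traffic_curves and um hm up hp :: real
  assumes "acc_dec_curves M" and "scanning_curves M" and "standing_assumption M"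
    and "(um, hm) \<in> Omega M" and "(up, hp) \<in> Omega M"
    and "um \<noteq> up"
    and "velocity M um hm = velocity M up hp"
  shows "shock_speed M (um, hm) (up, hp) = 0 \<and>
    infinite {(u, h). viscous_profile M (um, hm) (up, hp) u h}"
proof
  show "shock_speed M (um, hm) (up, hp) = 0" using assms(7) by (simp add: shock_speed_def)
  interpret hysteresis_traffic M by unfold_locales (rule assms)+
  let ?u = "\<lambda>\<kappa> \<xi>. um + (up - um) / (1 + exp (- \<kappa> * \<xi>)) :: real"
  obtain c where c: "c > 0"
    "\<And>\<kappa>. 0 < \<kappa> \<Longrightarrow> \<kappa> < c \<Longrightarrow> \<exists>h. viscous_profile M (um, hm) (up, hp) (?u \<kappa>) h"
    using stationary_profiles[OF assms(4-7)] by blast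
  \<comment> \<open>The parameter enters the differential equation for \<open>u\<close> itself, so these profiles are not translates of each other.\<close>
  have "inj_on ?u {0<..<c}"
  proof (rule inj_onI)
    fix \<kappa> \<kappa>' assume "?u \<kappa> = ?u \<kappa>'"
    then have "?u \<kappa> 1 = ?u \<kappa>' 1" by (rule fun_cong)
    then have "1 / (1 + exp (- \<kappa>)) = 1 / (1 + exp (- \<kappa>'))" using assms(6) by (simp add: divide_inverse)
    then have "1 + exp (- \<kappa>) = 1 + exp (- \<kappa>')" by (metis inverse_eq_divide inverse_eq_iff_eq)
    then show "\<kappa> = \<kappa>'" by simp
  qed
  moreover have "infinite {0<..<c}" using c(1) by (rule infinite_Ioo)
  ultimately have "infinite (?u ` {0<..<c})" using finite_imageD by blast
  moreover have "?u ` {0<..<c} \<subseteq> fst ` {(u, h). viscous_profile M (um, hm) (up, hp) u h}"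
    using c(2) by (force simp: image_iff)
  ultimately show "infinite {(u, h). viscous_profile M (um, hm) (up, hp) u h}"
    using finite_surj by blast
qed

end
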